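(* Let $\mathcal{A}$ be a unital $C^*$-algebra, $\mathcal{E}$ a right Hilbert $\mathcal{A}$-module, $H_1,H_2$ Hilbert spaces, $\varphi:\mathcal{A}\to\mathcal{B}(H_1)$ a completely positive map and $\Phi:\mathcal{E}\to\mathcal{B}(H_1,H_2)$ a completely semi-$\varphi$-map. Then there exists a unital completely positive map $\psi:\mathbb{K}_1(\mathcal{E})\to\mathcal{B}(H_2)$ such that $$\begin{bmatrix}\psi&\Phi\\ \Phi^*&\varphi\end{bmatrix}:\mathcal{L}_1(\mathcal{E})\to\mathcal{B}(H_2\oplus H_1)$$ is a completely positive map.
   Context: $\mathbb{K}(\mathcal{E})$ is the $C^*$-algebra of compact operators on $\mathcal{E}$ and $\mathbb{K}_1(\mathcal{E})=\mathbb{K}(\mathcal{E})+\mathbb{C}I_{\mathcal{E}}$. The (unitized) linking algebra is the unital $C^*$-algebra $\mathcal{L}_1(\mathcal{E})=\left\{\begin{bmatrix}u&x\\ y^*&a\end{bmatrix}: a\in\mathcal{A},\,u\in\mathbb{K}_1(\mathcal{E}),\,x,y\in\mathcal{E}\right\}$. The block notation $\begin{bmatrix}\psi&\Phi\\ \Phi^*&\varphi\end{bmatrix}$ denotes the map $\begin{bmatrix}u&x\\ y^*&a\end{bmatrix}\mapsto\begin{bmatrix}\psi(u)&\Phi(x)\\ \Phi(y)^*&\varphi(a)\end{bmatrix}$. $\mathbb{M}_n(\mathcal{E})$ is a right Hilbert $\mathbb{M}_n(\mathcal{A})$-module with $(x_{ij})\cdot(a_{ij})=(\sum_k x_{ik}a_{kj})$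 and $\langle (x_{ij}),(y_{ij})\rangle=(\sum_k\langle x_{ki},y_{kj}\rangle)$; $\Phi_n,\varphi_n$ are entrywise amplifications. A linear map $\Phi:\mathcal{E}\to\mathcal{B}(H_1,H_2)$ is a completely semi-$\varphi$-map if $\Phi_n(x)^*\Phi_n(x)\le\varphi_n(\langle x,x\rangle)$ for all $n\in\mathbb{N}$ and $x\in\mathbb{M}_n(\mathcal{E})$.
   Formalization: The formal theorem assumes in addition that E is nonzero or H_2 = 0; if E = {0} and H_2 is nonzero, then K_1(E) = {0} and I_E = 0, so no linear map psi can be unital and the claim fails. *)

theory Defs
  imports "HOL-Analysis.Analysis"
begin

section \<open>Complex normed spaces and Hilbert spaces\<close>

class complex_vector = real_vector +
  fixes scaleC :: "complex \<Rightarrow> 'a \<Rightarrow> 'a"  (infixr \<open>*\<^sub>C\<close> 75)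
  assumes scaleC_add_right: "c *\<^sub>C (x + y) = c *\<^sub>C x + c *\<^sub>C y"
    and scaleC_add_left: "(c + d) *\<^sub>C x = c *\<^sub>C x + d *\<^sub>C x"
    and scaleC_scaleC: "c *\<^sub>C d *\<^sub>C x = (c * d) *\<^sub>C x"
    and scaleC_one: "1 *\<^sub>C x = x"
    and scaleR_scaleC: "r *\<^sub>R x = complex_of_real r *\<^sub>C x"

lemma vector_space_scaleC: "vector_space (scaleC :: complex \<Rightarrow> 'a \<Rightarrow> 'a::complex_vector)"
  by unfold_locales
    (simp_all add: scaleC_add_right scaleC_add_left scaleC_scaleC scaleC_one)

abbreviation clinear :: "('a::complex_vector \<Rightarrow> 'b::complex_vector) \<Rightarrow> bool"
  where "clinear \<equiv> Vector_Spaces.linear scaleC scaleC"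

abbreviation cspan :: "'a::complex_vector set \<Rightarrow> 'a set"
  where "cspan \<equiv> module.span scaleC"

class complex_normed_vector = complex_vector + real_normed_vector +
  assumes norm_scaleC: "norm (c *\<^sub>C x) = cmod c * norm x"

class cbanach = complex_normed_vector + complete_space

text \<open>The inner product is conjugate linear in the first variable.\<close>

class complex_inner = complex_normed_vector +
  fixes cinner :: "'a \<Rightarrow> 'a \<Rightarrow> complex"
  assumes cinner_commute: "cinner x y = cnj (cinner y x)"
    and cinner_add_right: "cinner x (y + z) = cinner x y + cinner x z"
    and cinner_scaleC_right: "cinner x (c *\<^sub>C y) = c * cinner x y"
    and cinner_self_nonneg: "cinner x x \<in> \<real>\<^sub>\<ge>\<^sub>0"
    and norm_eq_sqrt_cinner: "norm x = sqrt (Re (cinner x x))"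

class chilbert_space = complex_inner + complete_space

instantiation prod :: (complex_vector, complex_vector) complex_vector
begin

definition scaleC_prod_def: "c *\<^sub>C p = (c *\<^sub>C fst p, c *\<^sub>C snd p)"

instance
  by standard
    (simp_all add: scaleC_prod_def scaleC_add_right scaleC_add_left scaleC_scaleC scaleC_one
      scaleR_scaleC scaleR_prod_def)

end

instance prod :: (complex_normed_vector, complex_normed_vector) complex_normed_vector
proof
  fix c :: complex and p :: "'a \<times> 'b"
  have "(cmod c * norm (fst p))\<^sup>2 + (cmod c * norm (snd p))\<^sup>2 =
      (cmod c)\<^sup>2 * ((norm (fst p))\<^sup>2 + (norm (snd p))\<^sup>2)"
    by (simp add: power_mult_distrib distrib_left)
  then show "norm (c *\<^sub>C p) = cmod c * norm p"
    by (simp add: norm_prod_def scaleC_prod_def norm_scaleC real_sqrt_mult)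
qed

text \<open>Hilbert space direct sum.\<close>

instantiation prod :: (complex_inner, complex_inner) complex_inner
begin

definition cinner_prod_def: "cinner p q = cinner (fst p) (fst q) + cinner (snd p) (snd q)"

instance
proof
  fix x y z :: "'a \<times> 'b" and c :: complex
  show "cinner x y = cnj (cinner y x)"
    by (simp add: cinner_prod_def flip: cinner_commute)
  show "cinner x (y + z) = cinner x y + cinner x z"
    by (simp add: cinner_prod_def cinner_add_right)
  show "cinner x (c *\<^sub>C y) = c * cinner x y"
    by (simp add: cinner_prod_def scaleC_prod_def cinner_scaleC_right distrib_left)
  show "cinner x x \<in> \<real>\<^sub>\<ge>\<^sub>0"
    by (simp add: cinner_prod_def cinner_self_nonneg nonneg_Reals_add_I)
  have "Re (cinner (fst x) (fst x)) \<ge> 0" "Re (cinner (snd x) (snd x)) \<ge> 0"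
    using cinner_self_nonneg complex_nonneg_Reals_iff by blast+
  then show "norm x = sqrt (Re (cinner x x))"
    by (simp add: norm_prod_def cinner_prod_def norm_eq_sqrt_cinner)
qed

end

instance prod :: (chilbert_space, chilbert_space) chilbert_space ..

section \<open>Bounded operators\<close>

text \<open>The type of bounded real-linear maps provides composition and the operator norm; bounded
  complex-linear operators form a subset of it.\<close>

instantiation blinfun :: (real_normed_vector, complex_normed_vector) complex_normed_vector
begin

definition scaleC_blinfun_def: "c *\<^sub>C T = Blinfun (\<lambda>x. c *\<^sub>C blinfun_apply T x)"

lemma bounded_linear_scaleC_comp:
  "bounded_linear (\<lambda>x. c *\<^sub>C blinfun_apply (T :: 'a \<Rightarrow>\<^sub>L 'b) x)"
proof (rule bounded_linear_intro)
  fix x y :: 'a and r :: real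
  show "c *\<^sub>C T (x + y) = c *\<^sub>C T x + c *\<^sub>C T y"
    by (simp add: blinfun.add_right scaleC_add_right)
  show "c *\<^sub>C T (r *\<^sub>R x) = r *\<^sub>R c *\<^sub>C T x"
    by (simp add: blinfun.scaleR_right scaleR_scaleC scaleC_scaleC mult.commute)
  show "norm (c *\<^sub>C T x) \<le> norm x * (cmod c * norm T)"
    using mult_left_mono[OF norm_blinfun[of T x] norm_ge_zero[of c]]
    by (simp add: norm_scaleC mult_ac)
qed

lemma scaleC_blinfun_apply: "blinfun_apply (c *\<^sub>C T) x = c *\<^sub>C blinfun_apply T x"
  for T :: "'a \<Rightarrow>\<^sub>L 'b"
  by (simp add: scaleC_blinfun_def bounded_linear_Blinfun_apply bounded_linear_scaleC_comp)

instance
proof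
  fix c d :: complex and r :: real and S T :: "'a \<Rightarrow>\<^sub>L 'b"
  show "c *\<^sub>C (S + T) = c *\<^sub>C S + c *\<^sub>C T"
    by (rule blinfun_eqI) (simp add: scaleC_blinfun_apply blinfun.add_left scaleC_add_right)
  show "(c + d) *\<^sub>C T = c *\<^sub>C T + d *\<^sub>C T"
    by (rule blinfun_eqI) (simp add: scaleC_blinfun_apply blinfun.add_left scaleC_add_left)
  show "c *\<^sub>C d *\<^sub>C T = (c * d) *\<^sub>C T"
    by (rule blinfun_eqI) (simp add: scaleC_blinfun_apply scaleC_scaleC)
  show "1 *\<^sub>C T = T"
    by (rule blinfun_eqI) (simp add: scaleC_blinfun_apply scaleC_one)
  show "r *\<^sub>R T = complex_of_real r *\<^sub>C T"
    by (rule blinfun_eqI) (simp add: scaleC_blinfun_apply blinfun.scaleR_left scaleR_scaleC)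
  show "norm (c *\<^sub>C T) = cmod c * norm T"
  proof -
    have le: "norm (e *\<^sub>C U) \<le> cmod e * norm U" for e and U :: "'a \<Rightarrow>\<^sub>L 'b"
    proof (rule norm_blinfun_bound)
      show "norm (blinfun_apply (e *\<^sub>C U) x) \<le> cmod e * norm U * norm x" for x
        using mult_left_mono[OF norm_blinfun[of U x] norm_ge_zero[of e]]
        by (simp add: norm_scaleC scaleC_blinfun_apply mult_ac)
    qed simp
    show ?thesis
    proof (cases "c = 0")
      case True
      then show ?thesis using le[of 0 T] by simp
    next
      case False
      have "inverse c *\<^sub>C c *\<^sub>C T = T"
        by (rule blinfun_eqI) (simp add: False scaleC_blinfun_apply scaleC_scaleC scaleC_one)
      then have "norm T \<le> inverse (cmod c) * norm (c *\<^sub>C T)"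
        using le[of "inverse c" "c *\<^sub>C T"] by (simp add: norm_inverse)
      then have "cmod c * norm T \<le> norm (c *\<^sub>C T)"
        using False by (simp add: field_simps)
      then show ?thesis using le[of c T] by simp
    qed
  qed
qed

end

definition bounded_ops ::
    "('h::complex_normed_vector \<Rightarrow>\<^sub>L 'k::complex_normed_vector) set"
  where "bounded_ops = {T. clinear (blinfun_apply T)}"

definition hilbert_adj ::
    "('h::complex_inner \<Rightarrow>\<^sub>L 'k::complex_inner) \<Rightarrow> ('k \<Rightarrow>\<^sub>L 'h)"
  where "hilbert_adj T = (THE S. \<forall>k h. cinner (blinfun_apply S k) h = cinner k (blinfun_apply T h))"

text \<open>Positivity in \<open>M\<^sub>n(B(H)) = B(H\<^sup>n)\<close>: \<open>\<langle>h, T h\<rangle> \<ge> 0\<close> for all \<open>h = (h\<^sub>0, \<dots>, h\<^sub>n\<^sub>-\<^sub>1)\<close>.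
  An \<open>n \<times> n\<close> matrix is a function on pairs of indices, of which only the values at indices
  below \<open>n\<close> matter.\<close>

definition op_matrix_positive :: "nat \<Rightarrow> (nat \<Rightarrow> nat \<Rightarrow> 'h::complex_inner \<Rightarrow>\<^sub>L 'h) \<Rightarrow> bool"
  where "op_matrix_positive n T \<longleftrightarrow>
    (\<forall>h. (\<Sum>i<n. cinner (h i) (\<Sum>j<n. T i j (h j))) \<in> \<real>\<^sub>\<ge>\<^sub>0)"

definition op_matrix_le ::
    "nat \<Rightarrow> (nat \<Rightarrow> nat \<Rightarrow> 'h::complex_inner \<Rightarrow>\<^sub>L 'h) \<Rightarrow> (nat \<Rightarrow> nat \<Rightarrow> 'h \<Rightarrow>\<^sub>L 'h) \<Rightarrow> bool"
  where "op_matrix_le n S T \<longleftrightarrow> op_matrix_positive n (\<lambda>i j. T i j - S i j)"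

section \<open>Completely positive maps\<close>

text \<open>The zero algebra (\<open>1 = 0\<close>) is not excluded, hence \<^class>\<open>monoid_mult\<close> instead of
  \<^class>\<open>real_normed_algebra_1\<close>.\<close>

class unital_cstar_algebra = real_normed_algebra + monoid_mult + cbanach +
  fixes star :: "'a \<Rightarrow> 'a"
  assumes scaleC_mult_left: "(c *\<^sub>C x) * y = c *\<^sub>C (x * y)"
    and scaleC_mult_right: "x * (c *\<^sub>C y) = c *\<^sub>C (x * y)"
    and star_star: "star (star x) = x"
    and star_add: "star (x + y) = star x + star y"
    and star_scaleC: "star (c *\<^sub>C x) = cnj c *\<^sub>C star x"
    and star_mult: "star (x * y) = star y * star x"
    and cstar_identity: "norm (star x * x) = (norm x)\<^sup>2"

text \<open>A C*-algebra given by a carrier set and its operations, the addition being that of the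
  type. The involution on \<open>K\<^sub>1(E)\<close> depends on the inner product of \<open>E\<close>, so it cannot come from
  a type class.\<close>

record 'x star_algebra =
  alg_carrier :: "'x set"
  alg_scale :: "complex \<Rightarrow> 'x \<Rightarrow> 'x"
  alg_mult :: "'x \<Rightarrow> 'x \<Rightarrow> 'x"
  alg_star :: "'x \<Rightarrow> 'x"

definition full_algebra :: "'a::unital_cstar_algebra star_algebra"
  where "full_algebra =
    \<lparr>alg_carrier = UNIV, alg_scale = scaleC, alg_mult = (*), alg_star = star\<rparr>"

text \<open>Positivity in the C*-algebra \<open>M\<^sub>n(S)\<close>: \<open>X = Y\<^sup>*Y\<close> for some \<open>Y\<close> in \<open>M\<^sub>n(S)\<close>.\<close>

definition matrix_positive ::
    "'x::ab_group_add star_algebra \<Rightarrow> nat \<Rightarrow> (nat \<Rightarrow> nat \<Rightarrow> 'x) \<Rightarrow> bool"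
  where "matrix_positive S n X \<longleftrightarrow>
    (\<exists>Y. (\<forall>i<n. \<forall>j<n. Y i j \<in> alg_carrier S) \<and>
         (\<forall>i<n. \<forall>j<n. X i j = (\<Sum>k<n. alg_mult S (alg_star S (Y k i)) (Y k j))))"

definition completely_positive ::
    "'x::ab_group_add star_algebra \<Rightarrow> ('x \<Rightarrow> ('h::chilbert_space \<Rightarrow>\<^sub>L 'h)) \<Rightarrow> bool"
  where "completely_positive S F \<longleftrightarrow>
    (\<forall>X\<in>alg_carrier S. F X \<in> bounded_ops) \<and>
    (\<forall>X\<in>alg_carrier S. \<forall>Y\<in>alg_carrier S. F (X + Y) = F X + F Y) \<and>
    (\<forall>c. \<forall>X\<in>alg_carrier S. F (alg_scale S c X) = c *\<^sub>C F X) \<and>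
    (\<forall>n X. matrix_positive S n X \<longrightarrow> op_matrix_positive n (\<lambda>i j. F (X i j)))"

section \<open>Hilbert modules and the linking algebra\<close>

text \<open>A right Hilbert module: \<open>act x a\<close> is \<open>x \<cdot> a\<close>, and \<open>ip\<close> is the algebra-valued inner product,
  conjugate linear in the first variable. Completeness is part of \<^class>\<open>cbanach\<close>, whose norm
  is required to be the one given by \<open>ip\<close>.\<close>

locale hilbert_module =
  fixes act :: "'e::cbanach \<Rightarrow> 'a::unital_cstar_algebra \<Rightarrow> 'e"
    and ip :: "'e \<Rightarrow> 'e \<Rightarrow> 'a"
  assumes act_add_left: "act (x + y) a = act x a + act y a"
    and act_add_right: "act x (a + b) = act x a + act x b"
    and act_act: "act (act x a) b = act x (a * b)"
    and act_one: "act x 1 = x"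
    and act_scaleC_left: "act (c *\<^sub>C x) a = c *\<^sub>C act x a"
    and act_scaleC_right: "act x (c *\<^sub>C a) = c *\<^sub>C act x a"
    and ip_add_right: "ip x (y + z) = ip x y + ip x z"
    and ip_scaleC_right: "ip x (c *\<^sub>C y) = c *\<^sub>C ip x y"
    and ip_act_right: "ip x (act y a) = ip x y * a"
    and ip_star: "star (ip x y) = ip y x"
    and ip_positive: "\<exists>b. ip x x = star b * b"
    and ip_definite: "ip x x = 0 \<Longrightarrow> x = 0"
    and norm_ip: "norm x = sqrt (norm (ip x x))"

definition rank_one ::
    "('e::cbanach \<Rightarrow> 'a::unital_cstar_algebra \<Rightarrow> 'e) \<Rightarrow> ('e \<Rightarrow> 'e \<Rightarrow> 'a) \<Rightarrow> 'e \<Rightarrow> 'e \<Rightarrow> ('e \<Rightarrow>\<^sub>L 'e)"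
  where "rank_one act ip x y = Blinfun (\<lambda>z. act x (ip y z))"

definition compact_ops ::
    "('e::cbanach \<Rightarrow> 'a::unital_cstar_algebra \<Rightarrow> 'e) \<Rightarrow> ('e \<Rightarrow> 'e \<Rightarrow> 'a) \<Rightarrow> ('e \<Rightarrow>\<^sub>L 'e) set"
  where "compact_ops act ip = closure (cspan {rank_one act ip x y | x y. True})"

definition module_adj ::
    "('e::cbanach \<Rightarrow> 'e \<Rightarrow> 'a::unital_cstar_algebra) \<Rightarrow> ('e \<Rightarrow>\<^sub>L 'e) \<Rightarrow> ('e \<Rightarrow>\<^sub>L 'e)"
  where "module_adj ip u = (THE v. \<forall>x y. ip (blinfun_apply v x) y = ip x (blinfun_apply u y))"

definition K1 ::
    "('e::cbanach \<Rightarrow> 'a::unital_cstar_algebra \<Rightarrow> 'e) \<Rightarrow> ('e \<Rightarrow> 'e \<Rightarrow> 'a) \<Rightarrow> ('e \<Rightarrow>\<^sub>L 'e) star_algebra"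
  where "K1 act ip =
    \<lparr>alg_carrier = {u + c *\<^sub>C id_blinfun | u c. u \<in> compact_ops act ip},
     alg_scale = scaleC, alg_mult = (o\<^sub>L), alg_star = module_adj ip\<rparr>"

text \<open>The tuple \<open>(u, x, y, a)\<close> stands for the matrix \<open>[u x; y\<^sup>* a]\<close>, acting on \<open>E \<oplus> A\<close> by
  \<open>(z, b) \<mapsto> (u z + x \<cdot> b, \<langle>y, z\<rangle> + a b)\<close>. Its entries multiply by \<open>x w\<^sup>* = rank_one x w\<close>,
  \<open>y\<^sup>* v = (v\<^sup>* y)\<^sup>*\<close>, \<open>a w\<^sup>* = (w \<cdot> a\<^sup>*)\<^sup>*\<close> and \<open>y\<^sup>* z = \<langle>y, z\<rangle>\<close>, and scaling conjugates the scalar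
  in the third component.\<close>

definition linking_algebra ::
    "('e::cbanach \<Rightarrow> 'a::unital_cstar_algebra \<Rightarrow> 'e) \<Rightarrow> ('e \<Rightarrow> 'e \<Rightarrow> 'a) \<Rightarrow>
     (('e \<Rightarrow>\<^sub>L 'e) \<times> 'e \<times> 'e \<times> 'a) star_algebra"
  where "linking_algebra act ip =
    \<lparr>alg_carrier = {(u, x, y, a). u \<in> alg_carrier (K1 act ip)},
     alg_scale = (\<lambda>c (u, x, y, a). (c *\<^sub>C u, c *\<^sub>C x, cnj c *\<^sub>C y, c *\<^sub>C a)),
     alg_mult = (\<lambda>(u, x, y, a) (v, z, w, b).
       ((u o\<^sub>L v) + rank_one act ip x w,
        u z + act x b,
        module_adj ip v y + act w (star a),
        ip y z + a * b)),
     alg_star = (\<lambda>(u, x, y, a). (module_adj ip u, y, x, star a))\<rparr>"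

definition block_op ::
    "('k \<Rightarrow>\<^sub>L 'k) \<Rightarrow> ('h \<Rightarrow>\<^sub>L 'k) \<Rightarrow> ('k \<Rightarrow>\<^sub>L 'h) \<Rightarrow> ('h \<Rightarrow>\<^sub>L 'h) \<Rightarrow>
     ('k::complex_normed_vector \<times> 'h::complex_normed_vector) \<Rightarrow>\<^sub>L ('k \<times> 'h)"
  where "block_op P Q R S = Blinfun (\<lambda>(k, h). (P k + Q h, R k + S h))"

definition block_map ::
    "(('e::cbanach \<Rightarrow>\<^sub>L 'e) \<Rightarrow> ('k::chilbert_space \<Rightarrow>\<^sub>L 'k)) \<Rightarrow> ('e \<Rightarrow> ('h::chilbert_space \<Rightarrow>\<^sub>L 'k)) \<Rightarrow>
     ('a::unital_cstar_algebra \<Rightarrow> ('h \<Rightarrow>\<^sub>L 'h)) \<Rightarrow>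
     ('e \<Rightarrow>\<^sub>L 'e) \<times> 'e \<times> 'e \<times> 'a \<Rightarrow> (('k \<times> 'h) \<Rightarrow>\<^sub>L ('k \<times> 'h))"
  where "block_map \<psi> \<Phi> \<phi> = (\<lambda>(u, x, y, a). block_op (\<psi> u) (\<Phi> x) (hilbert_adj (\<Phi> y)) (\<phi> a))"

definition completely_semi_map ::
    "('e::cbanach \<Rightarrow> 'e \<Rightarrow> 'a::unital_cstar_algebra) \<Rightarrow> ('a \<Rightarrow> ('h::chilbert_space \<Rightarrow>\<^sub>L 'h)) \<Rightarrow>
     ('e \<Rightarrow> ('h \<Rightarrow>\<^sub>L 'k::chilbert_space)) \<Rightarrow> bool"
  where "completely_semi_map ip \<phi> \<Phi> \<longleftrightarrow>
    (\<forall>x. \<Phi> x \<in> bounded_ops) \<and> clinear \<Phi> \<and>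
    (\<forall>n (x :: nat \<Rightarrow> nat \<Rightarrow> 'e).
      op_matrix_le n
        (\<lambda>i j. \<Sum>k<n. hilbert_adj (\<Phi> (x k i)) o\<^sub>L \<Phi> (x k j))
        (\<lambda>i j. \<phi> (\<Sum>k<n. ip (x k i) (x k j))))"

end

theory Submission
  imports Defs
begin

text \<open>
  Let \<open>K = \<E> \<otimes> H\<^sub>1\<close> carry the semi-inner product
  \<open>\<langle>x \<otimes> h, y \<otimes> k\<rangle> = \<langle>h, \<phi>(\<langle>x, y\<rangle>) k\<rangle>\<close>, let \<open>\<rho>(u)(x \<otimes> h) = u x \<otimes> h\<close>, and let
  \<open>W(x \<otimes> h) = \<Phi>(x) h\<close>. The inequality \<open>\<Phi>\<^sub>n(x)\<^sup>*\<Phi>\<^sub>n(x) \<le> \<phi>\<^sub>n(\<langle>x, x\<rangle>)\<close> for a matrix \<open>x\<close> with one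
  nonzero row says both that this form is positive and that \<open>W\<close> is a contraction
  (\<open>semi_row\<close>). Since \<open>u\<^sup>*u \<le> M\<close> is witnessed by \<open>M - u\<^sup>*u = M c\<^sup>*c\<close> with \<open>c\<close> adjointable, every
  \<open>\<rho>(u)\<close> is bounded (\<open>adjointable_dominated\<close>, \<open>app_bounded\<close>). The required map is
  \<open>\<psi>(u) = W \<rho>(u) W\<^sup>* + \<omega>(u) (1 - W W\<^sup>*)\<close>, where \<open>\<omega>\<close> is a state of \<open>\<K>\<^sub>1(\<E>)\<close>; it is unital.

  For the block map, a positive matrix over the linking algebra is a sum of matrices \<open>(Y\<^sub>i\<^sup>* Y\<^sub>j)\<close>
  with \<open>Y\<^sub>i = [u\<^sub>i x\<^sub>i; y\<^sub>i\<^sup>* a\<^sub>i]\<close>. On vectors \<open>(k\<^sub>i, h\<^sub>i)\<close>, the part without \<open>\<omega>\<close> is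
  \<open>\<parallel>\<Sum>\<^sub>i (\<rho>(u\<^sub>i) W\<^sup>*k\<^sub>i + x\<^sub>i \<otimes> h\<^sub>i)\<parallel>\<^sup>2\<close> plus the square norm of
  \<open>\<Sum>\<^sub>i (y\<^sub>i\<^sup>* W\<^sup>*k\<^sub>i + a\<^sub>i \<otimes> h\<^sub>i)\<close> in \<open>\<A> \<otimes> H\<^sub>1\<close>, whose form
  \<open>\<langle>a \<otimes> h, b \<otimes> k\<rangle> = \<langle>h, \<phi>(a\<^sup>*b) k\<rangle>\<close> is positive because \<open>\<phi>\<close> is completely positive. The part
  with \<open>\<omega>\<close> is the entrywise product of the positive matrices \<open>(\<omega>(\<dots>))\<close> and
  \<open>(\<langle>k\<^sub>i, (1 - W W\<^sup>*) k\<^sub>j\<rangle>)\<close>, and is positive by \<open>Schur_product\<close>. This is \<open>row_positive\<close>.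

  No completion of \<open>K\<close> is formed. Elements of \<open>K\<close> are lists of pairs \<open>(x, h)\<close>, and \<open>W\<^sup>*k\<close> is
  replaced by lists \<open>xi k n\<close> that represent the functional \<open>\<langle>k, W \<cdot>\<rangle>\<close> up to an error \<open>1/(n + 1)\<close>;
  they come from almost minimizing \<open>\<parallel>\<xi>\<parallel>\<^sup>2 - 2 Re \<langle>k, W \<xi>\<rangle>\<close> (\<open>approximate_Riesz\<close>). Then
  \<open>W \<rho>(u) W\<^sup>*k\<close> is the limit of \<open>W \<rho>(u) (xi k n)\<close> in \<open>H\<^sub>2\<close>.

  The state is \<open>\<omega>(u) = \<tau>(\<langle>x\<^sub>0, u x\<^sub>0\<rangle>)\<close> for a functional \<open>\<tau>\<close> on \<open>\<A>\<close> that is nonnegative on all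
  \<open>b\<^sup>*b\<close> and satisfies \<open>\<tau>(\<langle>x\<^sub>0, x\<^sub>0\<rangle>) = 1\<close> (\<open>positive_functional_exists\<close>). It is obtained from the
  Hahn--Banach theorem, applied to the distance from the negative cone. This needs that every
  \<open>b\<^sup>*b\<close> is positive (\<open>pos_star_mult_self\<close>, the theorem of Fukamiya, Kelley--Vaught and
  Kaplansky), which is proved with square roots only, without spectral theory.
\<close>


section \<open>Complex vector spaces\<close>

interpretation complex_vector: vector_space "scaleC :: complex \<Rightarrow> 'x \<Rightarrow> 'x::complex_vector"
  by (rule vector_space_scaleC)

lemma bounded_linear_scaleC: "bounded_linear (\<lambda>x. c *\<^sub>C x :: 'x::complex_normed_vector)"
  by (rule bounded_linear_intro[where K = "cmod c"])
    (simp_all add: complex_vector.scale_right_distrib scaleR_scaleC scaleC_scaleC norm_scaleC mult.commute)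

instance cbanach \<subseteq> banach ..

instance chilbert_space \<subseteq> cbanach ..

section \<open>Square roots by iteration\<close>

text \<open>The equation \<open>z = (x + z\<^sup>2)/2\<close> says \<open>(1 - z)\<^sup>2 = 1 - x\<close>, so this gives a square root of \<open>1 - x\<close> for
  \<open>\<parallel>x\<parallel> \<le> 1\<close>, including the boundary case. The multiplication is an arbitrary contractive bilinear map,
  because the lemma is needed both in a C*-algebra and for composition of operators. The set \<open>S\<close>
  carries further properties of \<open>x\<close> (selfadjointness, commutation) over to \<open>z\<close>.\<close>

lemma sqrt_iteration:
  fixes m :: "'x::banach \<Rightarrow> 'x \<Rightarrow> 'x"
  assumes bil: "bounded_bilinear m" and m_le: "\<And>x y. norm (m x y) \<le> norm x * norm y"
    and x: "norm x \<le> 1" and S: "closed S" "0 \<in> S" "\<And>z. z \<in> S \<Longrightarrow> (1/2) *\<^sub>R (x + m z z) \<in> S"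
  obtains z where "z \<in> S" "norm z \<le> 1" "z = (1/2) *\<^sub>R (x + m z z)"
proof -
  interpret m: bounded_bilinear m by (rule bil)
  define q where "q = rec_nat 0 (\<lambda>_ z. (1/2) *\<^sub>R (x + m z z))"
  have q0: "q 0 = 0" and qS: "q (Suc n) = (1/2) *\<^sub>R (x + m (q n) (q n))" for n
    by (simp_all add: q_def)
  \<comment> \<open>The same iteration for the number 1 is bounded and increasing; it dominates the increments of \<open>q\<close>.\<close>
  define r :: "nat \<Rightarrow> real" where "r = rec_nat 0 (\<lambda>_ z. (1/2) * (1 + z * z))"
  have r0: "r 0 = 0" and rS: "r (Suc n) = (1/2) * (1 + r n * r n)" for n
    by (simp_all add: r_def)
  have r01: "0 \<le> r n \<and> r n \<le> 1" for n
  proof (induction n)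
    case (Suc n)
    then have "r n * r n \<le> 1" by (simp add: mult_le_one)
    then show ?case by (simp add: rS)
  qed (simp add: r0)
  have r_mono: "r n \<le> r (Suc n)" for n
    using sum_squares_bound[of 1 "r n"] by (simp add: rS power2_eq_square)
  have qr: "norm (q n) \<le> r n" for n
  proof (induction n)
    case (Suc n)
    have "norm (m (q n) (q n)) \<le> r n * r n"
      using m_le[of "q n" "q n"] mult_mono[OF Suc Suc] r01[of n] by simp
    then have "norm (x + m (q n) (q n)) \<le> 1 + r n * r n"
      using x norm_triangle_ineq[of x "m (q n) (q n)"] by simp
    then show ?case by (simp add: qS rS)
  qed (simp add: q0 r0)
  have step: "norm (q (Suc n) - q n) \<le> r (Suc n) - r n" for n
  proof (induction n)
    case 0
    then show ?case using qr[of 1] by (simp add: q0 r0)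
  next
    case (Suc n)
    have "q (Suc (Suc n)) - q (Suc n)
        = (1/2) *\<^sub>R (m (q (Suc n)) (q (Suc n)) - m (q n) (q n))"
      by (simp add: qS flip: scaleR_diff_right)
    also have "\<dots> = (1/2) *\<^sub>R (m (q (Suc n)) (q (Suc n) - q n) + m (q (Suc n) - q n) (q n))"
      by (simp add: m.diff_left m.diff_right)
    also have "norm \<dots> \<le> (1/2) * (r (Suc n) * (r (Suc n) - r n) + (r (Suc n) - r n) * r n)"
    proof -
      have "norm (m (q (Suc n)) (q (Suc n) - q n)) \<le> r (Suc n) * (r (Suc n) - r n)"
        by (rule order_trans[OF m_le], rule mult_mono) (use Suc qr r01 in auto)
      moreover have "norm (m (q (Suc n) - q n) (q n)) \<le> (r (Suc n) - r n) * r n"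
        by (rule order_trans[OF m_le], rule mult_mono) (use Suc qr r01 r_mono in auto)
      ultimately show ?thesis
        by (simp, intro order_trans[OF norm_triangle_ineq] add_mono)
    qed
    also have "\<dots> = r (Suc (Suc n)) - r (Suc n)"
      by (simp only: rS[of "Suc n"] rS[of n]) (simp add: field_simps)
    finally show ?case .
  qed
  have far: "norm (q (n + k) - q n) \<le> r (n + k) - r n" for n k
  proof (induction k)
    case (Suc k)
    have "norm (q (n + Suc k) - q n) \<le> norm (q (Suc (n + k)) - q (n + k)) + norm (q (n + k) - q n)"
      using norm_triangle_ineq[of "q (Suc (n + k)) - q (n + k)" "q (n + k) - q n"] by simp
    then show ?case using Suc step[of "n + k"] by simp
  qed simp
  have "convergent r"
    by (rule Bseq_mono_convergent[OF BseqI'[of r 1]]) (use r01 in auto, use r_mono in \<open>blast intro: lift_Suc_mono_le\<close>)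
  then have "Cauchy r" by (rule convergent_Cauchy)
  have "Cauchy q"
  proof (rule metric_CauchyI)
    fix e :: real assume "0 < e"
    then obtain M where M: "\<And>i j. i \<ge> M \<Longrightarrow> j \<ge> M \<Longrightarrow> dist (r i) (r j) < e"
      using \<open>Cauchy r\<close> unfolding Cauchy_def by blast
    have le: "dist (q i) (q j) < e" if "i \<ge> M" "i \<le> j" for i j
      using far[of i "j - i"] M[of j i] that by (simp add: dist_norm norm_minus_commute)
    have "dist (q i) (q j) < e" if "i \<ge> M" "j \<ge> M" for i j
      using le[of i j] le[of j i] that by (cases "i \<le> j") (auto simp: dist_commute)
    then show "\<exists>M. \<forall>i\<ge>M. \<forall>j\<ge>M. dist (q i) (q j) < e" by blast
  qed
  then obtain z where z: "q \<longlonglongrightarrow> z"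
    by (auto simp: Cauchy_convergent_iff convergent_def)
  have "q n \<in> S" for n
    by (induction n) (auto simp: q0 qS S(2) intro: S(3))
  then have "z \<in> S" using S(1) z by (auto simp: closed_sequential_limits)
  moreover have "norm z \<le> 1"
    using tendsto_norm[OF z] qr r01 by (intro LIMSEQ_le_const2[OF tendsto_norm[OF z]]) (meson order_trans)
  moreover have "z = (1/2) *\<^sub>R (x + m z z)"
  proof (rule LIMSEQ_unique)
    show "(\<lambda>n. q (Suc n)) \<longlonglongrightarrow> z" using z by (rule LIMSEQ_Suc)
    show "(\<lambda>n. q (Suc n)) \<longlonglongrightarrow> (1/2) *\<^sub>R (x + m z z)"
      unfolding qS by (intro tendsto_intros z m.tendsto)
  qed
  ultimately show ?thesis using that by blast
qed

section \<open>Hahn--Banach\<close>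

text \<open>Sublinear functionals. Homogeneity is asked for \<open>t > 0\<close> only; the case \<open>t = 0\<close> follows.\<close>

definition sublinear :: "('v::real_vector \<Rightarrow> real) \<Rightarrow> bool"
  where "sublinear p \<longleftrightarrow> (\<forall>x y. p (x + y) \<le> p x + p y) \<and> (\<forall>t>0. \<forall>x. p (t *\<^sub>R x) = t * p x)"

lemma sublinear_zero: "sublinear p \<Longrightarrow> p 0 = 0"
proof -
  assume "sublinear p"
  then have "p (2 *\<^sub>R 0) = 2 * p 0" unfolding sublinear_def using zero_less_numeral by blast
  then show ?thesis by simp
qed

lemma sublinear_lower: "sublinear p \<Longrightarrow> - p (- x) \<le> p x"
  using sublinear_zero[of p] unfolding sublinear_def by (metis add.right_inverse minus_le_iff add_le_cancel_left diff_0 le_diff_eq add.commute)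

text \<open>The functional \<open>x \<mapsto> inf\<^sub>t\<^sub>\<ge>\<^sub>0 (p(x + t a) - t p(a))\<close>, the greatest sublinear functional below \<open>p\<close>
  whose value at \<open>-a\<close> is at most \<open>-p(a)\<close>.\<close>

definition sub_shift :: "('v::real_vector \<Rightarrow> real) \<Rightarrow> 'v \<Rightarrow> 'v \<Rightarrow> real"
  where "sub_shift p a x = (INF t\<in>{0..}. p (x + t *\<^sub>R a) - t * p a)"

lemma sub_shift_bdd:
  assumes p: "sublinear p"
  shows "bdd_below ((\<lambda>t. p (x + t *\<^sub>R a) - t * p a) ` {0..})"
proof (rule bdd_belowI2)
  fix t :: real assume "t \<in> {0..}"
  then have "p (t *\<^sub>R a) = t * p a"
    using p sublinear_zero[OF p] by (cases "t = 0") (auto simp: sublinear_def)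
  moreover have "p (t *\<^sub>R a) \<le> p (x + t *\<^sub>R a) + p (- x)"
    using p unfolding sublinear_def by (metis add.commute add_minus_cancel minus_add_cancel)
  ultimately show "- p (- x) \<le> p (x + t *\<^sub>R a) - t * p a" by simp
qed

lemma sub_shift_le:
  assumes p: "sublinear p" and "0 \<le> t"
  shows "sub_shift p a x \<le> p (x + t *\<^sub>R a) - t * p a"
  unfolding sub_shift_def by (rule cINF_lower[OF sub_shift_bdd[OF p]]) (use assms in auto)

lemma sublinear_sub_shift:
  assumes p: "sublinear p"
  shows "sublinear (sub_shift p a)"
  unfolding sublinear_def
proof (intro conjI allI impI)
  fix x y
  have *: "sub_shift p a (x + y) \<le> (p (x + t *\<^sub>R a) - t * p a) + (p (y + s *\<^sub>R a) - s * p a)"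
    if "0 \<le> t" "0 \<le> s" for t s
  proof -
    have "p ((x + t *\<^sub>R a) + (y + s *\<^sub>R a)) \<le> p (x + t *\<^sub>R a) + p (y + s *\<^sub>R a)"
      using p by (simp add: sublinear_def)
    then show ?thesis
      using sub_shift_le[OF p, of "t + s" a "x + y"] that
      by (simp add: algebra_simps)
  qed
  have "sub_shift p a (x + y) - (p (x + t *\<^sub>R a) - t * p a) \<le> sub_shift p a y" if "0 \<le> t" for t
    unfolding sub_shift_def[of p a y]
  proof (rule cINF_greatest)
    fix s :: real assume "s \<in> {0..}"
    with *[of t s] that
    show "sub_shift p a (x + y) - (p (x + t *\<^sub>R a) - t * p a) \<le> p (y + s *\<^sub>R a) - s * p a"
      by auto
  qed simp
  then have "sub_shift p a (x + y) - sub_shift p a y \<le> sub_shift p a x"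
    unfolding sub_shift_def[of p a x]
    by (intro cINF_greatest) (auto simp: algebra_simps)
  then show "sub_shift p a (x + y) \<le> sub_shift p a x + sub_shift p a y" by simp
next
  fix t :: real and x assume t: "0 < t"
  have le: "sub_shift p a (t *\<^sub>R x) \<le> t * sub_shift p a x" if t: "0 < t" for t x
  proof -
    have "sub_shift p a (t *\<^sub>R x) / t \<le> sub_shift p a x"
      unfolding sub_shift_def[of p a x]
    proof (rule cINF_greatest)
      fix s :: real assume s: "s \<in> {0..}"
      have "p (t *\<^sub>R (x + s *\<^sub>R a)) = t * p (x + s *\<^sub>R a)"
        using p t by (simp add: sublinear_def)
      then have "sub_shift p a (t *\<^sub>R x) \<le> t * (p (x + s *\<^sub>R a) - s * p a)"
        using sub_shift_le[OF p, of "t * s" a "t *\<^sub>R x"] s t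
        by (simp add: algebra_simps)
      then show "sub_shift p a (t *\<^sub>R x) / t \<le> p (x + s *\<^sub>R a) - s * p a"
        using t by (simp add: field_simps)
    qed simp
    then show ?thesis using t by (simp add: field_simps)
  qed
  from le[of "1/t" "t *\<^sub>R x"] t have "t * sub_shift p a x \<le> sub_shift p a (t *\<^sub>R x)"
    by (simp add: field_simps)
  with le[OF t, of x] show "sub_shift p a (t *\<^sub>R x) = t * sub_shift p a x" by simp
qed

text \<open>A minimal sublinear functional \<open>q\<close> equals each of its shifts, so \<open>q(-a) \<le> -q(a)\<close> for every \<open>a\<close>.\<close>

lemma minimal_sublinear_linear:
  assumes q: "sublinear q" and min: "\<And>q'. sublinear q' \<Longrightarrow> q' \<le> q \<Longrightarrow> q' = q"
  shows "linear q"
proof -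
  have odd: "q (- a) = - q a" for a
  proof -
    have "sub_shift q a \<le> q"
      using sub_shift_le[OF q, of 0] by (auto simp: le_fun_def)
    then have "sub_shift q a = q" by (rule min[OF sublinear_sub_shift[OF q]])
    then have "q (- a) \<le> - q a"
      using sub_shift_le[OF q, of 1 a "- a"] sublinear_zero[OF q] by simp
    then show ?thesis using sublinear_lower[OF q, of a] by simp
  qed
  have add: "q (x + y) = q x + q y" for x y
  proof -
    have 1: "q (x + y) \<le> q x + q y" for x y using q by (simp add: sublinear_def)
    from 1[of "x + y" "- y"] 1[of x y] show ?thesis by (simp add: odd)
  qed
  have "q (t *\<^sub>R x) = t * q x" for t x
  proof (cases t "0::real" rule: linorder_cases)
    case less
    then have "q ((- t) *\<^sub>R x) = (- t) * q x" using q by (simp only: sublinear_def)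
    then show ?thesis by (simp add: odd)
  qed (use q sublinear_zero[OF q] in \<open>auto simp: sublinear_def\<close>)
  with add show ?thesis by (intro linearI) auto
qed

lemma minimal_sublinear_exists:
  assumes p: "sublinear p"
  obtains q where "sublinear q" "q \<le> p" "\<And>q'. sublinear q' \<Longrightarrow> q' \<le> q \<Longrightarrow> q' = q"
proof -
  define F where "F = {q. sublinear q \<and> q \<le> p}"
  define R where "R = (\<lambda>f g :: 'a \<Rightarrow> real. g \<le> f)"
  have "\<exists>m\<in>F. \<forall>a\<in>F. R m a \<longrightarrow> a = m"
  proof (rule predicate_Zorn)
    show "partial_order_on F (relation_of R F)"
      unfolding R_def
      by (auto simp: partial_order_on_def preorder_on_def refl_on_def trans_def antisym_def
          relation_of_def)
  next
    fix C assume C: "C \<in> Chains (relation_of R F)"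
    then have CF: "C \<subseteq> F" and chain: "\<And>f g. f \<in> C \<Longrightarrow> g \<in> C \<Longrightarrow> f \<le> g \<or> g \<le> f"
      by (auto simp: Chains_def relation_of_def R_def)
    show "\<exists>u\<in>F. \<forall>a\<in>C. R a u"
    proof (cases "C = {}")
      case True
      then show ?thesis using p by (auto simp: F_def)
    next
      case False
      define u where "u x = (INF f\<in>C. f x)" for x
      have sub: "sublinear f" "f \<le> p" if "f \<in> C" for f using CF that by (auto simp: F_def)
      have bdd: "bdd_below ((\<lambda>f. f x) ` C)" for x
      proof (rule bdd_belowI2)
        fix f assume f: "f \<in> C"
        then have "f (- x) \<le> p (- x)" using sub(2) by (auto simp: le_fun_def)
        then show "- p (- x) \<le> f x" using sublinear_lower[OF sub(1)[OF f], of x] by simp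
      qed
      have u_le: "u x \<le> f x" if "f \<in> C" for f x
        unfolding u_def by (rule cINF_lower[OF bdd that])
      have u_ge: "b \<le> u x" if "\<And>f. f \<in> C \<Longrightarrow> b \<le> f x" for b x
        unfolding u_def by (rule cINF_greatest[OF False that])
      have "sublinear u"
        unfolding sublinear_def
      proof (intro conjI allI impI)
        fix x y
        have *: "u (x + y) \<le> f x + g y" if fg: "f \<in> C" "g \<in> C" for f g
        proof -
          obtain h where h: "h \<in> C" "h \<le> f" "h \<le> g" using chain[OF fg] fg by auto
          have "u (x + y) \<le> h x + h y"
            using u_le[OF h(1), of "x + y"] sub(1)[OF h(1)] unfolding sublinear_def
            by (meson order_trans)
          also have "\<dots> \<le> f x + g y" using h by (intro add_mono) (auto simp: le_fun_def)
          finally show ?thesis .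
        qed
        have "u (x + y) - f x \<le> u y" if "f \<in> C" for f
        proof (rule u_ge)
          fix g assume "g \<in> C"
          with *[OF that this] show "u (x + y) - f x \<le> g y" by simp
        qed
        then have "u (x + y) - u y \<le> u x"
          by (intro u_ge) (simp add: algebra_simps)
        then show "u (x + y) \<le> u x + u y" by simp
      next
        fix t :: real and x assume t: "0 < t"
        have hom: "f (t *\<^sub>R x) = t * f x" if "f \<in> C" for f
          using sub(1)[OF that] t by (simp add: sublinear_def)
        have "u (t *\<^sub>R x) / t \<le> u x"
          using u_le[of _ "t *\<^sub>R x"] hom t by (intro u_ge) (auto simp: field_simps)
        moreover have "t * u x \<le> u (t *\<^sub>R x)"
          using t by (intro u_ge) (simp add: hom u_le)
        ultimately show "u (t *\<^sub>R x) = t * u x" using t by (simp add: field_simps)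
      qed
      moreover have "u \<le> p"
      proof -
        obtain f where "f \<in> C" using False by blast
        then show ?thesis using u_le[of f] sub(2)[of f] by (auto simp: le_fun_def intro: order_trans)
      qed
      ultimately have "u \<in> F" by (simp add: F_def)
      then show ?thesis using u_le by (auto simp: R_def le_fun_def)
    qed
  qed
  then obtain q where "q \<in> F" "\<And>a. a \<in> F \<Longrightarrow> a \<le> q \<Longrightarrow> a = q" by (auto simp: R_def)
  then show ?thesis using that unfolding F_def by (smt (verit) mem_Collect_eq order_trans)
qed

text \<open>The supporting functional at \<open>a\<close> is a minimal sublinear functional below the shift of \<open>p\<close> at \<open>a\<close>;
  no partially defined functionals are extended.\<close>

theorem Hahn_Banach:
  assumes p: "sublinear p"
  obtains f where "linear f" "\<And>x. f x \<le> p x" "f a = p a"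
proof -
  obtain q where q: "sublinear q" "q \<le> sub_shift p a"
    "\<And>q'. sublinear q' \<Longrightarrow> q' \<le> q \<Longrightarrow> q' = q"
    using minimal_sublinear_exists[OF sublinear_sub_shift[OF p]] by blast
  have lin: "linear q" using minimal_sublinear_linear[OF q(1,3)] .
  have le: "q x \<le> p x" for x
    using q(2) sub_shift_le[OF p, of 0 a x] by (auto simp: le_fun_def intro: order_trans)
  have "q (- a) \<le> p (- a + 1 *\<^sub>R a) - 1 * p a"
    using q(2) sub_shift_le[OF p, of 1 a "- a"] by (auto simp: le_fun_def intro: order_trans)
  then have "q a = p a" using le[of a] linear_neg[OF lin, of a] sublinear_zero[OF p] by simp
  with lin le show ?thesis using that by blast
qed

section \<open>Positivity in a unital C*-algebra\<close>

lemma star_zero [simp]: "star (0 :: 'a::unital_cstar_algebra) = 0"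
  using star_add[of "0::'a" 0] by simp

lemma star_minus [simp]: "star (- x :: 'a::unital_cstar_algebra) = - star x"
  by (rule minus_unique[symmetric]) (simp flip: star_add)

lemma star_diff: "star (x - y :: 'a::unital_cstar_algebra) = star x - star y"
  using star_add[of x "- y"] by simp

lemma star_one [simp]: "star (1 :: 'a::unital_cstar_algebra) = 1"
  using star_mult[of "star (1::'a)" 1] by (simp add: star_star)

lemma star_scaleR: "star (r *\<^sub>R x :: 'a::unital_cstar_algebra) = r *\<^sub>R star x"
  by (simp add: scaleR_scaleC star_scaleC)

lemma star_sum: "star (\<Sum>i\<in>I. f i) = (\<Sum>i\<in>I. star (f i))" for f :: "'b \<Rightarrow> 'a::unital_cstar_algebra"
  by (induction I rule: infinite_finite_induct) (simp_all add: star_add)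

lemma norm_star [simp]: "norm (star x :: 'a::unital_cstar_algebra) = norm x"
proof -
  have le: "norm y \<le> norm (star y)" for y :: 'a
  proof (cases "y = 0")
    case False
    have "norm y * norm y \<le> norm (star y) * norm y"
      using cstar_identity[of y] norm_mult_ineq[of "star y" y] by (simp add: power2_eq_square)
    then show ?thesis using False by simp
  qed simp
  from le[of x] le[of "star x"] show ?thesis by (simp add: star_star)
qed

lemma bounded_linear_star: "bounded_linear (star :: 'a::unital_cstar_algebra \<Rightarrow> 'a)"
  by (rule bounded_linear_intro[where K = 1]) (simp_all add: star_add star_scaleR)

lemma star_mult_self_eq_0: "star x * x = 0 \<longleftrightarrow> (x :: 'a::unital_cstar_algebra) = 0"
  using cstar_identity[of x] by auto

lemma selfadjoint_square_eq_0: "star x = x \<Longrightarrow> x * x = 0 \<Longrightarrow> (x :: 'a::unital_cstar_algebra) = 0"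
  using star_mult_self_eq_0[of x] by simp

text \<open>Positive elements, characterized by norm: \<open>a\<close> is selfadjoint and \<open>\<parallel>\<parallel>a\<parallel> 1 - a\<parallel> \<le> \<parallel>a\<parallel>\<close>. This form makes the
  positive elements a closed set, and it will turn out to be equivalent both to
  \<open>\<parallel>t 1 - a\<parallel> \<le> t\<close> for some \<open>t \<ge> 0\<close> (\<open>posI\<close>) and to being the square of a selfadjoint element.\<close>

definition pos :: "'a::unital_cstar_algebra \<Rightarrow> bool"
  where "pos a \<longleftrightarrow> star a = a \<and> norm (norm a *\<^sub>R 1 - a) \<le> norm a"

lemma sqrt_one_minus:
  fixes x :: "'a::unital_cstar_algebra"
  assumes x: "norm x \<le> 1" "star x = x"
  obtains c where "star c = c" "c * c = 1 - x" "norm (1 - c) \<le> 1"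
    "\<And>w. w * x = x * w \<Longrightarrow> w * c = c * w"
proof -
  define S where "S = {z. star z = z \<and> (\<forall>w. w * x = x * w \<longrightarrow> w * z = z * w)}"
  have "closed {z::'a. star z = z}"
    by (intro closed_Collect_eq continuous_intros
        bounded_linear.continuous_on[OF bounded_linear_star])
  moreover have "closed {z. w * x = x * w \<longrightarrow> w * z = z * w}" for w :: 'a
    by (cases "w * x = x * w") (auto intro!: closed_Collect_eq continuous_intros)
  then have "closed (\<Inter>w. {z. w * x = x * w \<longrightarrow> w * z = z * w})" by blast
  ultimately have "closed ({z::'a. star z = z} \<inter> (\<Inter>w. {z. w * x = x * w \<longrightarrow> w * z = z * w}))"
    by (rule closed_Int)
  also have "{z::'a. star z = z} \<inter> (\<Inter>w. {z. w * x = x * w \<longrightarrow> w * z = z * w}) = S"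
    by (auto simp: S_def)
  finally have cl: "closed S" .
  have step: "(1/2) *\<^sub>R (x + z * z) \<in> S" if z: "z \<in> S" for z
  proof -
    have "w * (z * z) = (z * z) * w" if "w * x = x * w" for w
    proof -
      have wz: "w * z = z * w" using z that by (simp add: S_def)
      have "w * (z * z) = (w * z) * z" by (simp only: mult.assoc)
      also have "\<dots> = z * (w * z)" by (simp only: wz mult.assoc)
      also have "\<dots> = (z * z) * w" by (simp only: wz mult.assoc)
      finally show ?thesis .
    qed
    then have "w * ((1/2) *\<^sub>R (x + z * z)) = (1/2) *\<^sub>R (x + z * z) * w" if "w * x = x * w" for w
      using that by (simp add: distrib_left distrib_right)
    moreover have "star z = z" using z by (simp add: S_def)
    then have "star ((1/2) *\<^sub>R (x + z * z)) = (1/2) *\<^sub>R (x + z * z)"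
      by (simp add: star_scaleR star_add star_mult x)
    ultimately show ?thesis unfolding S_def by blast
  qed
  have zero: "0 \<in> S" by (simp add: S_def)
  obtain z where z: "z \<in> S" "norm z \<le> 1" "z = (1/2) *\<^sub>R (x + z * z)"
    using sqrt_iteration[OF bounded_bilinear_mult norm_mult_ineq x(1) cl zero step] by metis
  have zz: "z * z = z + z - x" using arg_cong[OF z(3), of "\<lambda>y. 2 *\<^sub>R y"] by (simp add: scaleR_2)
  show ?thesis
  proof (rule that[of "1 - z"])
    show "star (1 - z) = 1 - z" using z(1) by (simp add: S_def star_diff)
    show "(1 - z) * (1 - z) = 1 - x" by (simp add: algebra_simps zz)
    show "norm (1 - (1 - z)) \<le> 1" using z by simp
    show "w * (1 - z) = (1 - z) * w" if "w * x = x * w" for w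
      using that z(1) by (auto simp: S_def algebra_simps)
  qed
qed

lemma norm_one_le: "norm (1 :: 'a::unital_cstar_algebra) \<le> 1"
proof -
  have "norm (1::'a) = (norm (1::'a))\<^sup>2" using cstar_identity[of "1::'a"] by simp
  then have "norm (1::'a) = 0 \<or> norm (1::'a) = 1" by (simp add: power2_eq_square)
  then show ?thesis by auto
qed

text \<open>With \<open>c\<^sup>2 = 1 - h\<^sup>2\<close>, the element \<open>u = h + ic\<close> satisfies \<open>u\<^sup>*u = 1\<close>, so \<open>c = (u - u\<^sup>*)/2i\<close> is a contraction.\<close>

lemma norm_one_minus_square:
  fixes h :: "'a::unital_cstar_algebra"
  assumes h: "star h = h" "norm h \<le> 1"
  shows "norm (1 - h * h) \<le> 1"
proof -
  have "norm (h * h) \<le> 1"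
    using norm_mult_ineq[of h h] mult_le_one[of "norm h" "norm h"] h by simp
  moreover have "star (h * h) = h * h" by (simp add: star_mult h)
  ultimately obtain c where c: "star c = c" "c * c = 1 - h * h"
    "\<And>w. w * (h * h) = (h * h) * w \<Longrightarrow> w * c = c * w"
    by (rule sqrt_one_minus) blast
  have hc: "h * c = c * h" by (rule c(3)) (simp add: mult.assoc)
  define u where "u = h + \<i> *\<^sub>C c"
  have su: "star u = h - \<i> *\<^sub>C c" using h c(1) by (simp add: u_def star_add star_scaleC)
  have "star u * u = h * h + c * c"
    unfolding su unfolding u_def
    by (simp add: distrib_left left_diff_distrib scaleC_mult_left scaleC_mult_right hc scaleC_scaleC
        complex_vector.scale_right_diff_distrib complex_vector.scale_right_distrib)
  then have "norm (star u * u) \<le> 1" using norm_one_le by (simp add: c(2))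
  then have "norm u \<le> 1" by (simp add: cstar_identity power_le_one_iff abs_square_le_1)
  have "u - star u = (2 * \<i>) *\<^sub>C c"
    unfolding su unfolding u_def mult_2 scaleC_add_left by simp
  then have "2 * norm c = norm (u - star u)" by (simp add: norm_scaleC norm_mult)
  also have "\<dots> \<le> 2" using norm_triangle_ineq4[of u "star u"] \<open>norm u \<le> 1\<close> by simp
  finally have "norm c \<le> 1" by simp
  then have "norm (c * c) \<le> 1"
    using norm_mult_ineq[of c c] mult_le_one[of "norm c" "norm c"] by simp
  then show ?thesis by (simp add: c(2))
qed

lemma pos_square:
  fixes h :: "'a::unital_cstar_algebra"
  assumes h: "star h = h"
  shows "pos (h * h)"
proof (cases "h = 0")
  case False
  define g where "g = (1 / norm h) *\<^sub>R h"
  have hh: "norm (h * h) = norm h * norm h"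
    using cstar_identity[of h] h by (simp add: power2_eq_square)
  have "norm (1 - g * g) \<le> 1"
    by (rule norm_one_minus_square) (use h False in \<open>auto simp: g_def star_scaleR\<close>)
  moreover have "norm (h * h) *\<^sub>R (1 - g * g) = norm (h * h) *\<^sub>R 1 - h * h"
    using False by (simp add: g_def hh scaleR_right_diff_distrib)
  ultimately have "norm (norm (h * h) *\<^sub>R 1 - h * h) \<le> norm (h * h)"
    by (metis mult_left_le norm_ge_zero norm_scaleR abs_norm_cancel)
  then show ?thesis using h by (simp add: pos_def star_mult)
qed (simp add: pos_def)

text \<open>The square root commutes with everything that commutes with the given element.\<close>

lemma pos_sqrt:
  fixes a :: "'a::unital_cstar_algebra"
  assumes a: "star a = a" "0 \<le> t" "norm (t *\<^sub>R 1 - a) \<le> t"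
  obtains r where "star r = r" "r * r = a" "norm (sqrt t *\<^sub>R 1 - r) \<le> sqrt t"
    "\<And>w. w * a = a * w \<Longrightarrow> w * r = r * w"
proof (cases "t = 0")
  case True
  then have "a = 0" using a by simp
  then show ?thesis using that[of 0] True by simp
next
  case False
  then have t: "t > 0" using a by simp
  define x where "x = 1 - (1 / t) *\<^sub>R a"
  have "t *\<^sub>R x = t *\<^sub>R 1 - a" using t by (simp add: x_def scaleR_right_diff_distrib)
  then have "t * norm x \<le> t" using a(3) t by (metis abs_of_pos norm_scaleR)
  then have "norm x \<le> 1" using t by simp
  moreover have "star x = x" using a by (simp add: x_def star_diff star_scaleR)
  ultimately obtain c where c: "star c = c" "c * c = 1 - x" "norm (1 - c) \<le> 1"
    "\<And>w. w * x = x * w \<Longrightarrow> w * c = c * w"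
    by (rule sqrt_one_minus) blast
  show ?thesis
  proof (rule that[of "sqrt t *\<^sub>R c"])
    show "star (sqrt t *\<^sub>R c) = sqrt t *\<^sub>R c" by (simp add: star_scaleR c(1))
    show "(sqrt t *\<^sub>R c) * (sqrt t *\<^sub>R c) = a" using t by (simp add: c(2)) (simp add: x_def)
    have "norm (sqrt t *\<^sub>R (1 - c)) \<le> sqrt t"
      using c(3) t by (simp add: mult_left_le)
    then show "norm (sqrt t *\<^sub>R 1 - sqrt t *\<^sub>R c) \<le> sqrt t"
      by (simp add: scaleR_right_diff_distrib)
    show "w * (sqrt t *\<^sub>R c) = sqrt t *\<^sub>R c * w" if "w * a = a * w" for w
      using c(4)[of w] that by (simp add: x_def algebra_simps)
  qed
qed

lemma posI:
  fixes a :: "'a::unital_cstar_algebra"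
  assumes "star a = a" "0 \<le> t" "norm (t *\<^sub>R 1 - a) \<le> t"
  shows "pos a"
proof -
  obtain r where "star r = r" "r * r = a" using pos_sqrt[OF assms] by blast
  then show ?thesis using pos_square by blast
qed

lemma pos_iff_square: "pos a \<longleftrightarrow> (\<exists>r. star r = r \<and> r * r = a)"
proof
  assume "pos a"
  then have "star a = a" "norm (norm a *\<^sub>R 1 - a) \<le> norm a" by (auto simp: pos_def)
  from pos_sqrt[OF this(1) norm_ge_zero this(2)] show "\<exists>r. star r = r \<and> r * r = a" by blast
qed (use pos_square in blast)

lemma pos_add:
  assumes "pos a" "pos b"
  shows "pos (a + b)"
proof (rule posI)
  show "star (a + b) = a + b" using assms by (simp add: pos_def star_add)
  show "0 \<le> norm a + norm b" by simp
  have "norm ((norm a *\<^sub>R 1 - a) + (norm b *\<^sub>R 1 - b)) \<le> norm a + norm b"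
    using assms by (intro norm_triangle_mono) (auto simp: pos_def)
  then show "norm ((norm a + norm b) *\<^sub>R 1 - (a + b)) \<le> norm a + norm b"
    by (simp add: algebra_simps)
qed

lemma pos_scaleR:
  assumes "pos a" "0 \<le> t"
  shows "pos (t *\<^sub>R a)"
proof -
  obtain r where "star r = r" "r * r = a" using assms pos_iff_square by blast
  then show ?thesis
    using pos_square[of "sqrt t *\<^sub>R r"] assms by (simp add: star_scaleR)
qed

lemma pos_zero: "pos 0"
  by (simp add: pos_def)

lemma closed_pos: "closed {a :: 'a::unital_cstar_algebra. pos a}"
  unfolding pos_def
  by (intro closed_Collect_conj closed_Collect_eq closed_Collect_le continuous_intros
      bounded_linear.continuous_on[OF bounded_linear_star])

text \<open>Write \<open>a = h\<^sup>2\<close> and \<open>-a = g\<^sup>2\<close> with commuting selfadjoint \<open>h\<close>, \<open>g\<close>. Then \<open>x = h + ig\<close> satisfies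
  \<open>x\<^sup>*x = h\<^sup>2 + g\<^sup>2 = 0\<close>, hence \<open>x = 0\<close>.\<close>

lemma pos_antisym:
  fixes a :: "'a::unital_cstar_algebra"
  assumes "pos a" "pos (- a)"
  shows "a = 0"
proof -
  have sa: "star a = a" "norm (norm a *\<^sub>R 1 - a) \<le> norm a" using assms(1) by (auto simp: pos_def)
  have sb: "star (- a) = - a" "norm (norm (- a) *\<^sub>R 1 - (- a)) \<le> norm (- a)"
    using assms(2) unfolding pos_def by blast+
  obtain h where h: "star h = h" "h * h = a" "\<And>w. w * a = a * w \<Longrightarrow> w * h = h * w"
    using pos_sqrt[OF sa(1) norm_ge_zero sa(2)] by metis
  obtain g where g: "star g = g" "g * g = - a" "\<And>w. w * (- a) = (- a) * w \<Longrightarrow> w * g = g * w"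
    using pos_sqrt[OF sb(1) norm_ge_zero sb(2)] by metis
  have "h * a = a * h" using h(3)[of a] by simp
  then have hg: "h * g = g * h" by (intro g(3)) simp
  define x where "x = h + \<i> *\<^sub>C g"
  have "star x * x = h * h + g * g"
    by (simp add: x_def star_add star_scaleC h(1) g(1) distrib_left left_diff_distrib scaleC_mult_left
        scaleC_mult_right hg scaleC_scaleC complex_vector.scale_right_distrib
        complex_vector.scale_right_diff_distrib)
  then have x0: "x = 0" using star_mult_self_eq_0[of x] by (simp add: h(1,2) g(1,2))
  then have "star x = 0" by simp
  then have "x + star x = 0" using x0 by simp
  moreover have "x + star x = 2 *\<^sub>R h"
    by (simp add: x_def star_add star_scaleC h(1) g(1) scaleR_2)
  ultimately have "h = 0" by simp
  then show ?thesis using h(2) by simp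
qed

text \<open>The sum \<open>d\<^sup>*d + d d\<^sup>*\<close> is positive, being half the sum of the squares of \<open>d + d\<^sup>*\<close> and
  \<open>i(d - d\<^sup>*)\<close>.\<close>

lemma neg_both_eq_0:
  fixes d :: "'a::unital_cstar_algebra"
  assumes "pos (- (star d * d))" "pos (- (d * star d))"
  shows "d = 0"
proof -
  define h k where "h = d + star d" and "k = \<i> *\<^sub>C (d - star d)"
  have sa: "star h = h" "star k = k"
    by (simp_all add: h_def k_def star_add star_diff star_scaleC star_star algebra_simps
        complex_vector.scale_right_diff_distrib)
  have kk: "k * k = - ((d - star d) * (d - star d))"
    by (simp add: k_def scaleC_mult_left scaleC_mult_right scaleC_scaleC)
  have eq: "h * h + k * k = 2 *\<^sub>R (star d * d + d * star d)"
    unfolding kk h_def by (simp add: algebra_simps scaleR_2)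
  have "pos (h * h + k * k)" using sa pos_square pos_add by blast
  then have "pos ((1/2) *\<^sub>R (h * h + k * k))" by (rule pos_scaleR) simp
  then have "pos (star d * d + d * star d)" by (simp add: eq)
  from pos_add[OF this assms(2)] have "pos (star d * d)" by simp
  then have "star d * d = 0" using assms(1) by (rule pos_antisym)
  then show ?thesis by (simp add: star_mult_self_eq_0)
qed

text \<open>For \<open>d = c y\<close> one computes \<open>d\<^sup>*d = -y\<^sup>4\<close> and \<open>d d\<^sup>* = -(c c\<^sup>*)\<^sup>2\<close>, so the preceding lemma applies.
  This takes the place of the usual argument with the spectra of \<open>c\<^sup>*c\<close> and \<open>c c\<^sup>*\<close>.\<close>

lemma star_mult_self_neg_square_eq_0:
  fixes c y :: "'a::unital_cstar_algebra"
  assumes y: "star y = y" "star c * c = - (y * y)"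
  shows "c = 0"
proof -
  define d where "d = c * y"
  have 1: "star d * d = - ((y * y) * (y * y))"
  proof -
    have "star d * d = y * (star c * c) * y" by (simp add: d_def star_mult y(1) mult.assoc)
    then show ?thesis unfolding y(2) by (simp add: mult.assoc)
  qed
  have 2: "d * star d = - ((c * star c) * (c * star c))"
  proof -
    have "d * star d = - (c * (- (y * y)) * star c)" by (simp add: d_def star_mult y(1) mult.assoc)
    then show ?thesis unfolding y(2)[symmetric] by (simp add: mult.assoc)
  qed
  have "d = 0"
  proof (rule neg_both_eq_0)
    show "pos (- (star d * d))" using pos_square[of "y * y"] by (simp add: 1 star_mult y(1))
    show "pos (- (d * star d))" using pos_square[of "c * star c"]
      by (simp add: 2 star_mult star_star)
  qed
  then have "(c * star c) * (c * star c) = 0" using 2 by simp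
  then have "c * star c = 0" by (rule selfadjoint_square_eq_0[rotated]) (simp add: star_mult star_star)
  then have "star c = 0" using star_mult_self_eq_0[of "star c"] by (simp add: star_star)
  then show ?thesis by (metis star_star star_zero)
qed

text \<open>With \<open>a = b\<^sup>*b\<close>, \<open>m = (a\<^sup>2)\<^sup>1\<^sup>/\<^sup>2\<close>, \<open>r = m\<^sup>1\<^sup>/\<^sup>2\<close> and \<open>n = m - a\<close> (twice the negative part of \<open>a\<close>), one
  has \<open>a n = -m n\<close> and hence \<open>(b n)\<^sup>*(b n) = n a n = -(r n)\<^sup>2\<close>. By the preceding lemma \<open>b n = 0\<close>, and
  \<open>n = 0\<close> follows, that is \<open>a = m = r\<^sup>2\<close>.\<close>

theorem pos_star_mult_self: "pos (star b * b)" for b :: "'a::unital_cstar_algebra"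
proof -
  define a where "a = star b * b"
  have a: "star a = a" by (simp add: a_def star_mult star_star)
  have "pos (a * a)" using pos_square[OF a] .
  then have aa: "star (a * a) = a * a" "norm (norm (a * a) *\<^sub>R 1 - a * a) \<le> norm (a * a)"
    unfolding pos_def by blast+
  obtain m where m: "star m = m" "m * m = a * a"
    "norm (sqrt (norm (a * a)) *\<^sub>R 1 - m) \<le> sqrt (norm (a * a))"
    "\<And>w. w * (a * a) = a * a * w \<Longrightarrow> w * m = m * w"
    by (rule pos_sqrt[OF aa(1) norm_ge_zero aa(2)]) blast
  have am: "a * m = m * a" by (rule m(4)) (simp add: mult.assoc)
  obtain r where r: "star r = r" "r * r = m" "\<And>w. w * m = m * w \<Longrightarrow> w * r = r * w"
    by (rule pos_sqrt[OF m(1) real_sqrt_ge_zero[OF norm_ge_zero] m(3)]) blast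
  define n where "n = m - a"
  have n: "star n = n" by (simp add: n_def star_diff m(1) a)
  have an: "a * n = - (m * n)" by (simp add: n_def algebra_simps m(2) am)
  have nn: "n * n = 2 *\<^sub>R (m * n)" by (simp add: n_def algebra_simps m(2) am scaleR_2)
  have mn: "m * n = n * m" by (simp add: n_def algebra_simps am)
  have nr: "n * r = r * n" by (rule r(3)) (simp add: mn)
  define y where "y = r * n"
  have "star (b * n) * (b * n) = n * (a * n)" by (simp add: star_mult n a_def mult.assoc)
  also have "\<dots> = - (y * y)"
  proof -
    have "n * (m * n) = (n * r) * (r * n)" by (simp only: r(2)[symmetric] mult.assoc)
    then show ?thesis by (simp add: an y_def nr)
  qed
  finally have "b * n = 0"
    by (rule star_mult_self_neg_square_eq_0[rotated]) (simp add: y_def star_mult n r(1) nr)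
  then have "y * y = 0"
    using \<open>star (b * n) * (b * n) = n * (a * n)\<close> \<open>n * (a * n) = - (y * y)\<close> by simp
  then have "y = 0" by (rule selfadjoint_square_eq_0[rotated]) (simp add: y_def star_mult n r(1) nr)
  then have "m * n = 0" by (simp add: r(2)[symmetric] y_def mult.assoc)
  then have "n * n = 0" by (simp add: nn)
  with n have "n = 0" by (rule selfadjoint_square_eq_0)
  then have "a = r * r" by (simp add: n_def r(2))
  then show ?thesis using pos_square[OF r(1)] by (simp add: a_def)
qed

section \<open>Positive functionals\<close>

text \<open>The selfadjoint part of an element.\<close>

definition real_part :: "'a::unital_cstar_algebra \<Rightarrow> 'a" where "real_part a = (1/2) *\<^sub>R (a + star a)"

text \<open>The distance from the selfadjoint part of \<open>a\<close> to the cone of negative elements. It is sublinear, it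
  vanishes at negative elements, and it is strictly positive at positive nonzero elements.\<close>

definition dist_neg :: "'a::unital_cstar_algebra \<Rightarrow> real"
  where "dist_neg a = (INF c\<in>{c. pos c}. norm (real_part a + c))"

lemma real_part_add: "real_part (a + b) = real_part a + real_part b"
  by (simp add: real_part_def star_add algebra_simps)

lemma real_part_scaleR: "real_part (t *\<^sub>R a) = t *\<^sub>R real_part a"
  by (simp add: real_part_def star_scaleR algebra_simps)

lemma real_part_selfadjoint: "star a = a \<Longrightarrow> real_part a = a"
  by (simp add: real_part_def flip: scaleR_2)

lemma dist_neg_le: "pos c \<Longrightarrow> dist_neg a \<le> norm (real_part a + c)"
  unfolding dist_neg_def by (rule cINF_lower) (auto intro!: bdd_belowI2[where m = 0])

lemma dist_neg_ge: "(\<And>c. pos c \<Longrightarrow> b \<le> norm (real_part a + c)) \<Longrightarrow> b \<le> dist_neg a"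
  unfolding dist_neg_def by (rule cINF_greatest) (auto intro: pos_zero)

lemma sublinear_dist_neg: "sublinear (dist_neg :: 'a::unital_cstar_algebra \<Rightarrow> real)"
  unfolding sublinear_def
proof (intro conjI allI impI)
  fix a b :: 'a
  have *: "dist_neg (a + b) \<le> norm (real_part a + c) + norm (real_part b + d)" if "pos c" "pos d" for c d
  proof -
    have "dist_neg (a + b) \<le> norm ((real_part a + c) + (real_part b + d))"
      using dist_neg_le[OF pos_add[OF that], of "a + b"] by (simp add: real_part_add algebra_simps)
    then show ?thesis using norm_triangle_ineq order_trans by blast
  qed
  have "dist_neg (a + b) - norm (real_part a + c) \<le> dist_neg b" if "pos c" for c
    using *[OF that] by (intro dist_neg_ge) (simp add: algebra_simps)
  then have "dist_neg (a + b) - dist_neg b \<le> dist_neg a"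
    by (intro dist_neg_ge) (simp add: algebra_simps)
  then show "dist_neg (a + b) \<le> dist_neg a + dist_neg b" by simp
next
  fix t :: real and a :: 'a assume t: "0 < t"
  have le: "dist_neg (t *\<^sub>R a) \<le> t * dist_neg a" if t: "0 < t" for t and a :: 'a
  proof -
    have "dist_neg (t *\<^sub>R a) / t \<le> dist_neg a"
    proof (rule dist_neg_ge)
      fix c :: 'a assume "pos c"
      then have "dist_neg (t *\<^sub>R a) \<le> norm (real_part (t *\<^sub>R a) + t *\<^sub>R c)"
        using t by (intro dist_neg_le pos_scaleR) auto
      also have "\<dots> = t * norm (real_part a + c)"
        using t by (simp add: real_part_scaleR flip: scaleR_right_distrib)
      finally show "dist_neg (t *\<^sub>R a) / t \<le> norm (real_part a + c)" using t by (simp add: field_simps)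
    qed
    then show ?thesis using t by (simp add: field_simps)
  qed
  from le[of "1/t" "t *\<^sub>R a"] t have "t * dist_neg a \<le> dist_neg (t *\<^sub>R a)"
    by (simp add: field_simps)
  with le[OF t, of a] show "dist_neg (t *\<^sub>R a) = t * dist_neg a" by simp
qed

lemma dist_neg_pos:
  assumes "pos a" "a \<noteq> 0"
  shows "0 < dist_neg a"
proof -
  have ra: "real_part a = a" using assms by (intro real_part_selfadjoint) (simp add: pos_def)
  have "\<not> pos (- a)" using assms pos_antisym by blast
  then obtain e where e: "e > 0" "\<And>y. dist y (- a) < e \<Longrightarrow> \<not> pos y"
    using closed_pos[unfolded closed_def open_dist] by (metis ComplI ComplD mem_Collect_eq)
  have "e \<le> dist_neg a"
  proof (rule dist_neg_ge)
    fix c :: 'a assume "pos c"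
    then have "\<not> dist c (- a) < e" using e(2) by blast
    then show "e \<le> norm (real_part a + c)" by (simp add: ra dist_norm add.commute)
  qed
  with e(1) show ?thesis by simp
qed

text \<open>Complex-linear functionals that are nonnegative at every \<open>b\<^sup>*b\<close>; no normalization.\<close>

definition positive_functional :: "('a::unital_cstar_algebra \<Rightarrow> complex) \<Rightarrow> bool"
  where "positive_functional f \<longleftrightarrow> (\<forall>a b. f (a + b) = f a + f b) \<and> (\<forall>c a. f (c *\<^sub>C a) = c * f a) \<and>
    (\<forall>b. f (star b * b) \<in> \<real>\<^sub>\<ge>\<^sub>0)"

theorem positive_functional_exists:
  fixes b0 :: "'a::unital_cstar_algebra"
  assumes b0: "b0 \<noteq> 0"
  obtains f where "positive_functional f" "f (star b0 * b0) = 1"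
proof -
  define a0 where "a0 = star b0 * b0"
  have a0: "0 < dist_neg a0"
    unfolding a0_def by (rule dist_neg_pos) (use b0 in \<open>auto simp: pos_star_mult_self star_mult_self_eq_0\<close>)
  obtain g where g: "linear g" "\<And>x. g x \<le> dist_neg x" "g a0 = dist_neg a0"
    using Hahn_Banach[OF sublinear_dist_neg] by blast
  interpret g: linear g by (rule g(1))
  define h where "h a = g (real_part a)" for a
  have h_add: "h (a + b) = h a + h b" for a b by (simp add: h_def real_part_add g.add)
  have h_scale: "h (t *\<^sub>R a) = t * h a" for t a by (simp add: h_def real_part_scaleR g.scale)
  \<comment> \<open>The complexification of the real functional \<open>g\<close> on selfadjoint elements, divided by \<open>g a0\<close>.\<close>
  define f where "f a = (complex_of_real (h a) - \<i> * h (\<i> *\<^sub>C a)) / dist_neg a0" for a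
  have f_add: "f (a + b) = f a + f b" for a b
    by (simp add: f_def h_add complex_vector.scale_right_distrib algebra_simps add_divide_distrib diff_divide_distrib)
  have f_scaleR: "f (t *\<^sub>R a) = t * f a" for t a
  proof -
    have "\<i> *\<^sub>C t *\<^sub>R a = t *\<^sub>R \<i> *\<^sub>C a" by (simp add: scaleR_scaleC scaleC_scaleC mult.commute)
    then show ?thesis by (simp add: f_def h_scale algebra_simps diff_divide_distrib)
  qed
  have f_i: "f (\<i> *\<^sub>C a) = \<i> * f a" for a
  proof -
    have "h (\<i> *\<^sub>C \<i> *\<^sub>C a) = - h a"
      using h_scale[of "-1" a] by (simp add: scaleC_scaleC)
    then show ?thesis by (simp add: f_def algebra_simps diff_divide_distrib add_divide_distrib)
  qed
  have f_scaleC: "f (c *\<^sub>C a) = c * f a" for c a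
  proof -
    have "c *\<^sub>C a = Re c *\<^sub>R a + Im c *\<^sub>R \<i> *\<^sub>C a"
      by (simp add: scaleR_scaleC scaleC_scaleC mult.commute[of _ \<i>] flip: scaleC_add_left complex_eq)
    then have "f (c *\<^sub>C a) = Re c * f a + Im c * (\<i> * f a)"
      by (simp only: f_add f_scaleR f_i)
    also have "\<dots> = (Re c + \<i> * Im c) * f a" by (simp add: algebra_simps)
    finally show ?thesis by (simp only: complex_eq[symmetric])
  qed
  have f_pos: "f a = complex_of_real (g a / dist_neg a0)" if "star a = a" for a
  proof -
    have "real_part (\<i> *\<^sub>C a) = 0" by (simp add: real_part_def star_scaleC that)
    then show ?thesis by (simp add: f_def h_def real_part_selfadjoint[OF that] g.zero)
  qed
  have "f (star b * b) \<in> \<real>\<^sub>\<ge>\<^sub>0" for b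
  proof -
    define a where "a = star b * b"
    have sa: "star a = a" by (simp add: a_def star_mult star_star)
    have "dist_neg (- a) \<le> norm (real_part (- a) + a)"
      using dist_neg_le[OF pos_star_mult_self[of b], of "- a"] by (simp add: a_def)
    moreover have "real_part (- a) = - a" by (rule real_part_selfadjoint) (simp add: sa)
    ultimately have "g (- a) \<le> 0" using g(2)[of "- a"] by simp
    then have "0 \<le> g a" by (simp add: g.neg)
    then have "f a \<in> \<real>\<^sub>\<ge>\<^sub>0" using a0 by (simp add: f_pos[OF sa])
    then show ?thesis by (simp add: a_def)
  qed
  moreover have "f a0 = 1" using a0 by (simp add: f_pos a0_def star_mult star_star g(3)[unfolded a0_def])
  ultimately show ?thesis using that[of f] f_add f_scaleC
    by (simp add: positive_functional_def a0_def)
qed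

section \<open>Inner products and adjoints\<close>

text \<open>The discriminant of a nonnegative quadratic polynomial on the complex plane.\<close>

lemma quadratic_nonneg_bound:
  fixes e :: complex and a b :: real
  assumes ge: "\<And>t. 0 \<le> a + 2 * Re (t * e) + (cmod t)\<^sup>2 * b" and "0 \<le> a" "0 \<le> b"
  shows "(cmod e)\<^sup>2 \<le> a * b"
proof -
  define E where "E = (cmod e)\<^sup>2"
  have q: "0 \<le> a - 2 * r * E + r\<^sup>2 * E * b" for r :: real
  proof -
    have "Re (complex_of_real (- r) * cnj e * e) = - r * E"
      unfolding E_def cmod_power2 by (simp add: algebra_simps power2_eq_square)
    moreover have "(cmod (complex_of_real (- r) * cnj e))\<^sup>2 = r\<^sup>2 * E"
      by (simp add: E_def norm_mult power_mult_distrib)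
    ultimately show ?thesis using ge[of "complex_of_real (- r) * cnj e"] by simp
  qed
  show ?thesis
  proof (cases "b = 0")
    case True
    have "E = 0"
    proof (rule ccontr)
      assume "E \<noteq> 0"
      then show False using q[of "(a + 1) / E"] \<open>0 \<le> a\<close> True by simp
    qed
    then show ?thesis by (simp add: E_def True)
  next
    case False
    have "0 \<le> a - E / b"
      using q[of "1 / b"] False by (simp add: power2_eq_square)
    then show ?thesis using False \<open>0 \<le> b\<close> by (simp add: E_def field_simps)
  qed
qed

text \<open>A semi-inner product on a type with an addition and a scaling that need not satisfy the vector space
  axioms. It applies to Hilbert spaces as well as to lists of pairs, which represent elements of a
  tensor product, with concatenation as addition. It is conjugate linear in the first variable.\<close>

locale semi_inner =
  fixes add :: "'v \<Rightarrow> 'v \<Rightarrow> 'v" and sc :: "complex \<Rightarrow> 'v \<Rightarrow> 'v" and s :: "'v \<Rightarrow> 'v \<Rightarrow> complex"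
  assumes s_add_right: "s p (add q r) = s p q + s p r"
    and s_scale_right: "s p (sc c q) = c * s p q"
    and s_commute: "s p q = cnj (s q p)"
    and s_nonneg: "0 \<le> Re (s p p)"
begin

text \<open>The seminorm, and the formal difference \<open>p + (-1) q\<close>.\<close>

definition nrm :: "'v \<Rightarrow> real" where "nrm p = sqrt (Re (s p p))"

definition diff :: "'v \<Rightarrow> 'v \<Rightarrow> 'v" where "diff p q = add p (sc (- 1) q)"

lemma s_add_left: "s (add p q) r = s p r + s q r"
  using s_add_right[of r p q] s_commute by (metis complex_cnj_add)

lemma s_scale_left: "s (sc c p) q = cnj c * s p q"
  using s_scale_right[of q c p] s_commute by (metis complex_cnj_mult)

lemma s_diff_left: "s (diff p q) r = s p r - s q r"
  by (simp add: diff_def s_add_left s_scale_left)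

lemma s_diff_right: "s r (diff p q) = s r p - s r q"
  by (simp add: diff_def s_add_right s_scale_right)

lemma s_self: "s p p = complex_of_real ((nrm p)\<^sup>2)"
proof -
  have "Im (s p p) = 0" using s_commute[of p p] by (simp add: complex_eq_iff)
  then show ?thesis using s_nonneg[of p] by (simp add: complex_eq_iff nrm_def)
qed

lemma nrm_ge_0 [simp]: "0 \<le> nrm p"
  by (simp add: nrm_def s_nonneg)

lemma nrm_sq: "(nrm p)\<^sup>2 = Re (s p p)"
  by (simp add: nrm_def s_nonneg)

lemma nrm_sq_add_scale:
  "(nrm (add p (sc t q)))\<^sup>2 = (nrm p)\<^sup>2 + 2 * Re (t * s p q) + (cmod t)\<^sup>2 * (nrm q)\<^sup>2"
proof -
  have "s (add p (sc t q)) (add p (sc t q))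
      = s p p + (t * s p q + cnj (t * s p q)) + (t * cnj t) * s q q"
    using s_commute[of q p]
    by (simp add: s_add_left s_add_right s_scale_left s_scale_right algebra_simps)
  then show ?thesis
    by (simp only: nrm_sq) (simp add: s_self complex_mult_cnj cmod_power2)
qed

lemma Cauchy_Schwarz: "cmod (s p q) \<le> nrm p * nrm q"
proof -
  have "(cmod (s p q))\<^sup>2 \<le> (nrm p)\<^sup>2 * (nrm q)\<^sup>2"
  proof (rule quadratic_nonneg_bound)
    show "0 \<le> (nrm p)\<^sup>2 + 2 * Re (t * s p q) + (cmod t)\<^sup>2 * (nrm q)\<^sup>2" for t
      using nrm_sq_add_scale[of p t q] by (metis zero_le_power2)
  qed auto
  then have "(cmod (s p q))\<^sup>2 \<le> (nrm p * nrm q)\<^sup>2" by (simp add: power_mult_distrib)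
  then show ?thesis by (rule power2_le_imp_le) simp
qed

end

lemma clinear_add: "clinear f \<Longrightarrow> f (x + y) = f x + f y"
  by (simp add: Vector_Spaces.linear_iff)

lemma clinear_scaleC: "clinear f \<Longrightarrow> f (c *\<^sub>C x) = c *\<^sub>C f x"
  by (simp add: Vector_Spaces.linear_iff)

interpretation hilbert: semi_inner "(+)" scaleC "cinner :: 'h::complex_inner \<Rightarrow> 'h \<Rightarrow> complex"
  rewrites "semi_inner.nrm cinner = (norm :: 'h \<Rightarrow> real)"
    and "semi_inner.diff (+) scaleC = ((-) :: 'h \<Rightarrow> 'h \<Rightarrow> 'h)"
proof -
  show semi: "semi_inner (+) scaleC (cinner :: 'h \<Rightarrow> 'h \<Rightarrow> complex)"
  proof
    show "0 \<le> Re (cinner p p)" for p :: 'h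
      using cinner_self_nonneg[of p] by (simp add: complex_nonneg_Reals_iff)
  qed (rule cinner_add_right cinner_scaleC_right cinner_commute)+
  show "semi_inner.nrm cinner = (norm :: 'h \<Rightarrow> real)"
    using semi by (auto simp: fun_eq_iff semi_inner.nrm_def norm_eq_sqrt_cinner)
  show "semi_inner.diff (+) scaleC = ((-) :: 'h \<Rightarrow> 'h \<Rightarrow> 'h)"
    using semi_inner.diff_def[OF semi] by (simp add: fun_eq_iff complex_vector.scale_minus_left scaleC_one)
qed

lemmas cinner_add_left = hilbert.s_add_left
lemmas cinner_scaleC_left = hilbert.s_scale_left
lemmas cinner_diff_left = hilbert.s_diff_left
lemmas cinner_diff_right = hilbert.s_diff_right

lemma cinner_zero_right [simp]: "cinner x 0 = 0" and cinner_zero_left [simp]: "cinner 0 x = 0"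
  using cinner_diff_right[of x 0 0] cinner_diff_left[of 0 0 x] by simp_all

lemma cinner_sum_right: "cinner x (\<Sum>i\<in>I. f i) = (\<Sum>i\<in>I. cinner x (f i))"
  by (induction I rule: infinite_finite_induct) (simp_all add: cinner_add_right)

lemma cinner_sum_left: "cinner (\<Sum>i\<in>I. f i) x = (\<Sum>i\<in>I. cinner (f i) x)"
  by (induction I rule: infinite_finite_induct) (simp_all add: cinner_add_left)

lemma bounded_bilinear_cinner: "bounded_bilinear (cinner :: 'h::complex_inner \<Rightarrow> 'h \<Rightarrow> complex)"
proof
  show "\<exists>K. \<forall>a b. cmod (cinner a b) \<le> norm (a::'h) * norm b * K"
    by (intro exI[of _ 1]) (simp add: hilbert.Cauchy_Schwarz)
qed (simp_all add: cinner_add_left cinner_add_right cinner_scaleC_left cinner_scaleC_right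
    scaleR_scaleC scaleR_conv_of_real)

lemma cinner_eqI: "(\<And>z. cinner z x = cinner z y) \<Longrightarrow> x = (y :: 'h::complex_inner)"
proof -
  assume eq: "\<And>z. cinner z x = cinner z y"
  have "cinner (x - y) (x - y) = 0" by (simp only: cinner_diff_right[of "x - y"]) (simp add: eq)
  then show ?thesis by (simp add: hilbert.s_self)
qed

context semi_inner
begin

text \<open>An approximate Riesz representation of the functional \<open>\<langle>k, W \<cdot>\<rangle>\<close> without completeness: a vector that
  minimizes \<open>J(p) = \<parallel>p\<parallel>\<^sup>2 - 2 Re \<langle>k, W p\<rangle>\<close> up to \<open>e\<^sup>2\<close> represents the functional up to an error of norm at
  most \<open>e\<close>.\<close>

lemma approximate_Riesz:
  fixes W :: "'v \<Rightarrow> 'k::complex_inner"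
  assumes W_add: "\<And>p q. W (add p q) = W p + W q" and W_scale: "\<And>c p. W (sc c p) = c *\<^sub>C W p"
    and W_le: "\<And>p. norm (W p) \<le> M * nrm p" and e: "0 < e"
  obtains r where "\<And>q. cmod (s r q - cinner k (W q)) \<le> e * nrm q"
proof -
  define J where "J p = (nrm p)\<^sup>2 - 2 * Re (cinner k (W p))" for p
  have bdd: "bdd_below (range J)"
  proof (rule bdd_belowI2)
    fix p
    have "\<bar>Re (cinner k (W p))\<bar> \<le> norm k * (M * nrm p)"
      using abs_Re_le_cmod hilbert.Cauchy_Schwarz mult_left_mono[OF W_le norm_ge_zero]
      by (meson order_trans)
    moreover have "2 * (norm k * (M * nrm p)) \<le> (norm k * M)\<^sup>2 + (nrm p)\<^sup>2"
      using sum_squares_bound[of "norm k * M" "nrm p"] by (simp add: mult_ac)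
    ultimately show "- (norm k * M)\<^sup>2 \<le> J p" by (simp add: J_def)
  qed
  have "Inf (range J) < Inf (range J) + e\<^sup>2" using e by simp
  then obtain r where r: "J r < Inf (range J) + e\<^sup>2"
    using cInf_lessD[of "range J"] by blast
  have near: "J r - e\<^sup>2 \<le> J p" for p
    using cInf_lower[OF rangeI bdd, of p] r by simp
  show ?thesis
  proof (rule that)
    fix q
    have "(cmod (s r q - cinner k (W q)))\<^sup>2 \<le> e\<^sup>2 * (nrm q)\<^sup>2"
    proof (rule quadratic_nonneg_bound)
      fix t
      have "J (add r (sc t q)) = J r + 2 * Re (t * (s r q - cinner k (W q))) + (cmod t)\<^sup>2 * (nrm q)\<^sup>2"
        by (simp add: J_def nrm_sq_add_scale W_add W_scale cinner_add_right cinner_scaleC_right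
            algebra_simps)
      then show "0 \<le> e\<^sup>2 + 2 * Re (t * (s r q - cinner k (W q))) + (cmod t)\<^sup>2 * (nrm q)\<^sup>2"
        using near[of "add r (sc t q)"] by simp
    qed auto
    then have "(cmod (s r q - cinner k (W q)))\<^sup>2 \<le> (e * nrm q)\<^sup>2" by (simp add: power_mult_distrib)
    then show "cmod (s r q - cinner k (W q)) \<le> e * nrm q"
      by (rule power2_le_imp_le) (use e in simp)
  qed
qed

text \<open>Vectors that represent the same functional up to \<open>d\<close> and \<open>e\<close> are at distance at most \<open>d + e\<close>.\<close>

lemma nrm_diff_le:
  assumes "\<And>q. cmod (s r q - f q) \<le> d * nrm q" "\<And>q. cmod (s r' q - f q) \<le> e * nrm q"
    and "0 \<le> d" "0 \<le> e"
  shows "nrm (diff r r') \<le> d + e"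
proof -
  let ?q = "diff r r'"
  have "(nrm ?q)\<^sup>2 = cmod (s ?q ?q)" by (simp only: s_self) (simp add: norm_power)
  also have "s ?q ?q = (s r ?q - f ?q) - (s r' ?q - f ?q)" by (simp add: s_diff_left)
  also have "cmod \<dots> \<le> d * nrm ?q + e * nrm ?q"
    by (rule order_trans[OF norm_triangle_ineq4 add_mono[OF assms(1,2)]])
  finally have "nrm ?q * nrm ?q \<le> (d + e) * nrm ?q" by (simp add: power2_eq_square algebra_simps)
  then show ?thesis using assms nrm_ge_0[of ?q] by (cases "nrm ?q = 0") auto
qed

end

lemma Cauchy_inverse_Suc:
  fixes f :: "nat \<Rightarrow> 'x::real_normed_vector"
  assumes le: "\<And>m n. norm (f m - f n) \<le> C * (inverse (Suc m) + inverse (Suc n))"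
  shows "Cauchy f"
proof (rule metric_CauchyI)
  fix e :: real assume e: "0 < e"
  have "(\<lambda>n. \<bar>C\<bar> * inverse (real (Suc n))) \<longlonglongrightarrow> \<bar>C\<bar> * 0"
    by (intro tendsto_intros LIMSEQ_inverse_real_of_nat)
  then have "eventually (\<lambda>n. \<bar>C\<bar> * inverse (real (Suc n)) < e / 2) sequentially"
    using e by (intro order_tendstoD) auto
  then obtain N where N: "\<And>n. n \<ge> N \<Longrightarrow> \<bar>C\<bar> * inverse (real (Suc n)) < e / 2"
    by (auto simp: eventually_sequentially)
  have "dist (f m) (f n) < e" if "m \<ge> N" "n \<ge> N" for m n
  proof -
    have "C * (inverse (real (Suc m)) + inverse (real (Suc n)))
        \<le> \<bar>C\<bar> * (inverse (real (Suc m)) + inverse (real (Suc n)))"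
      by (intro mult_right_mono) auto
    then show ?thesis
      using le[of m n] N[OF that(1)] N[OF that(2)] by (simp add: dist_norm distrib_left)
  qed
  then show "\<exists>M. \<forall>m\<ge>M. \<forall>n\<ge>M. dist (f m) (f n) < e" by blast
qed

lemma bounded_ops_iff: "T \<in> bounded_ops \<longleftrightarrow> (\<forall>c x. T (c *\<^sub>C x) = c *\<^sub>C T x)"
  by (auto simp: bounded_ops_def Vector_Spaces.linear_iff vector_space_scaleC blinfun.add_right)

text \<open>A map with a formal adjoint and a norm bound is a bounded operator.\<close>

lemma adjoint_pair_blinfun:
  fixes f :: "'k::complex_inner \<Rightarrow> 'h::complex_inner" and g :: "'h \<Rightarrow> 'k"
  assumes adj: "\<And>x y. cinner (f x) y = cinner x (g y)" and le: "\<And>x. norm (f x) \<le> C * norm x"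
  shows "blinfun_apply (Blinfun f) = f" "Blinfun f \<in> bounded_ops"
proof -
  have adj': "cinner y (f x) = cinner (g y) x" for x y
    using adj[of x y] cinner_commute by metis
  have add: "f (x + y) = f x + f y" for x y
    by (rule cinner_eqI) (simp add: adj' cinner_add_right)
  have scale: "f (c *\<^sub>C x) = c *\<^sub>C f x" for c x
    by (rule cinner_eqI) (simp add: adj' cinner_scaleC_right)
  have "bounded_linear f"
    by (rule bounded_linear_intro[where K = C])
      (simp_all add: add scale scaleR_scaleC le mult.commute)
  then show "blinfun_apply (Blinfun f) = f" by (rule bounded_linear_Blinfun_apply)
  then show "Blinfun f \<in> bounded_ops" by (simp add: bounded_ops_iff scale)
qed

lemma hilbert_adj_exists:
  fixes T :: "'h::chilbert_space \<Rightarrow>\<^sub>L 'k::complex_inner"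
  assumes T: "T \<in> bounded_ops"
  obtains S where "S \<in> bounded_ops" "\<And>k h. cinner (blinfun_apply S k) h = cinner k (T h)"
proof -
  have "\<exists>v. \<forall>h. cinner v h = cinner k (T h)" for k
  proof -
    have "\<exists>r. \<forall>q. cmod (cinner r q - cinner k (T q)) \<le> inverse (real (Suc n)) * norm q" for n
    proof -
      have sc: "T (c *\<^sub>C p) = c *\<^sub>C T p" for c p using T by (simp add: bounded_ops_iff)
      have "0 < inverse (real (Suc n))" by simp
      from hilbert.approximate_Riesz[where W = "blinfun_apply T" and k = k,
          OF blinfun.add_right sc norm_blinfun this]
      show ?thesis by blast
    qed
    then obtain r where r: "\<And>n q. cmod (cinner (r n) q - cinner k (T q)) \<le> inverse (real (Suc n)) * norm q"
      by metis
    have "norm (r m - r n) \<le> 1 * (inverse (Suc m) + inverse (Suc n))" for m n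
      using hilbert.nrm_diff_le[OF r r] by simp
    then have "Cauchy r" by (rule Cauchy_inverse_Suc)
    then obtain v where v: "r \<longlonglongrightarrow> v" by (auto simp: Cauchy_convergent_iff convergent_def)
    have "cinner v h = cinner k (T h)" for h
    proof (rule LIMSEQ_unique)
      show "(\<lambda>n. cinner (r n) h) \<longlonglongrightarrow> cinner v h"
        by (intro bounded_bilinear.tendsto[OF bounded_bilinear_cinner] v tendsto_const)
      have "(\<lambda>n. cinner (r n) h - cinner k (T h)) \<longlonglongrightarrow> 0"
      proof (rule Lim_null_comparison)
        show "\<forall>\<^sub>F n in sequentially. norm (cinner (r n) h - cinner k (T h)) \<le> inverse (real (Suc n)) * norm h"
          by (rule always_eventually) (rule allI, rule r)
        show "(\<lambda>n. inverse (real (Suc n)) * norm h) \<longlonglongrightarrow> 0"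
          by (rule tendsto_mult_left_zero[OF LIMSEQ_inverse_real_of_nat])
      qed
      then show "(\<lambda>n. cinner (r n) h) \<longlonglongrightarrow> cinner k (T h)" by (simp add: LIM_zero_iff)
    qed
    then show ?thesis by blast
  qed
  then obtain S where S: "\<And>k h. cinner (S k) h = cinner k (T h)" by metis
  have "norm (S k) \<le> norm T * norm k" for k
  proof -
    have "(norm (S k))\<^sup>2 = cmod (cinner (S k) (S k))" by (simp only: hilbert.s_self) (simp add: norm_power)
    also have "\<dots> \<le> norm k * norm (T (S k))" unfolding S by (rule hilbert.Cauchy_Schwarz)
    also have "\<dots> \<le> norm k * (norm T * norm (S k))" by (intro mult_left_mono norm_blinfun) simp
    finally have "norm (S k) * norm (S k) \<le> (norm T * norm k) * norm (S k)"
      by (simp add: power2_eq_square mult_ac)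
    then show ?thesis by (cases "S k = 0") auto
  qed
  from adjoint_pair_blinfun[OF S this] S that[of "Blinfun S"] show ?thesis by simp
qed

text \<open>Every bounded complex-linear operator on a Hilbert space has an adjoint, so the definite description in
  \<^const>\<open>hilbert_adj\<close> is meaningful.\<close>

lemma hilbert_adj:
  fixes T :: "'h::chilbert_space \<Rightarrow>\<^sub>L 'k::complex_inner"
  assumes T: "T \<in> bounded_ops"
  shows "cinner (hilbert_adj T k) h = cinner k (T h)"
    and "cinner h (hilbert_adj T k) = cinner (T h) k"
    and "hilbert_adj T \<in> bounded_ops"
proof -
  obtain S where S: "S \<in> bounded_ops" "\<And>k h. cinner (blinfun_apply S k) h = cinner k (T h)"
    using hilbert_adj_exists[OF T] by blast
  have "hilbert_adj T = S"
    unfolding hilbert_adj_def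
  proof (rule the_equality)
    fix S' assume S': "\<forall>k h. cinner (blinfun_apply S' k) h = cinner k (T h)"
    show "S' = S"
    proof (rule blinfun_eqI, rule cinner_eqI)
      fix k z
      have "cnj (cinner (S' k) z) = cnj (cinner (S k) z)" by (simp add: S S')
      then show "cinner z (S' k) = cinner z (S k)" by (simp flip: cinner_commute)
    qed
  qed (simp add: S)
  then show *: "cinner (hilbert_adj T k) h = cinner k (T h)" and "hilbert_adj T \<in> bounded_ops"
    using S by auto
  have "cnj (cinner (hilbert_adj T k) h) = cnj (cinner k (T h))" by (simp add: *)
  then show "cinner h (hilbert_adj T k) = cinner (T h) k" by (simp flip: cinner_commute)
qed

section \<open>The Schur product theorem\<close>

lemma (in semi_inner) s_eq_0: "s v v = 0 \<Longrightarrow> s v q = 0" "s v v = 0 \<Longrightarrow> s q v = 0"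
proof -
  assume "s v v = 0"
  then have "nrm v = 0" by (simp add: s_self)
  then show "s v q = 0" using Cauchy_Schwarz[of v q] by simp
  then show "s q v = 0" using s_commute[of q v] by simp
qed

text \<open>The Schur complement with respect to \<open>v\<close>: the form induced on the orthogonal complement of \<open>v\<close>. If
  \<open>s v v = 0\<close>, the quotient is \<open>0\<close> and the form is unchanged, as it should be because then
  \<open>s v q = 0\<close> for all \<open>q\<close>.\<close>

lemma (in semi_inner) semi_inner_complement: "semi_inner add sc (\<lambda>p q. s p q - s p v * s v q / s v v)"
proof
  show "s p q - s p v * s v q / s v v = cnj (s q p - s q v * s v p / s v v)" for p q
    by (simp add: s_commute[symmetric] mult.commute)
  show "0 \<le> Re (s p p - s p v * s v p / s v v)" for p
  proof (cases "s v v = 0")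
    case False
    then have v: "0 < (nrm v)\<^sup>2" by (simp add: s_self)
    have "(cmod (s p v))\<^sup>2 \<le> (nrm p * nrm v)\<^sup>2" by (intro power_mono Cauchy_Schwarz) simp
    then have "(cmod (s p v))\<^sup>2 / (nrm v)\<^sup>2 \<le> (nrm p)\<^sup>2"
      using v by (simp add: power_mult_distrib divide_le_eq)
    moreover have "s p v * s v p = complex_of_real ((cmod (s p v))\<^sup>2)"
      by (subst s_commute[of v p]) (simp only: complex_norm_square)
    then have "s p v * s v p / s v v = complex_of_real ((cmod (s p v))\<^sup>2 / (nrm v)\<^sup>2)"
      by (simp only: s_self of_real_divide)
    ultimately show ?thesis by (simp only: s_self minus_complex.simps Re_complex_of_real)
  qed (simp add: s_nonneg)
qed (simp_all add: s_add_right s_scale_right algebra_simps add_divide_distrib)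

lemma nonneg_Reals_sum: "(\<And>i. i \<in> I \<Longrightarrow> f i \<in> \<real>\<^sub>\<ge>\<^sub>0) \<Longrightarrow> (\<Sum>i\<in>I. f i) \<in> (\<real>\<^sub>\<ge>\<^sub>0 :: complex set)"
  by (induction I rule: infinite_finite_induct) (auto intro: nonneg_Reals_add_I)

text \<open>Positive semidefinite complex matrices of size \<open>n\<close>.\<close>

definition psd_matrix :: "nat \<Rightarrow> (nat \<Rightarrow> nat \<Rightarrow> complex) \<Rightarrow> bool"
  where "psd_matrix n G \<longleftrightarrow> (\<forall>c. (\<Sum>i<n. \<Sum>j<n. cnj (c i) * c j * G i j) \<in> \<real>\<^sub>\<ge>\<^sub>0)"

text \<open>The Schur product theorem, for the Gram matrix of \<open>v\<close> and a positive semidefinite matrix \<open>G\<close>. In the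
  induction step, \<open>s\<close> is split into its Schur complement with respect to the last vector, which
  reduces to \<open>n\<close> vectors, and a form of rank one, for which the positivity of \<open>G\<close> is used directly.\<close>

theorem Schur_product:
  assumes "semi_inner add sc s" "psd_matrix n G"
  shows "(\<Sum>i<n. \<Sum>j<n. s (v i) (v j) * G i j) \<in> \<real>\<^sub>\<ge>\<^sub>0"
  using assms
proof (induction n arbitrary: s)
  case (Suc n)
  interpret semi_inner add sc s by (rule Suc.prems(1))
  define s' where "s' p q = s p q - s p (v n) * s (v n) q / s (v n) (v n)" for p q
  have s'_0: "s' (v n) q = 0" "s' q (v n) = 0" for q
    using s_eq_0[of "v n" q] by (cases "s (v n) (v n) = 0"; simp add: s'_def)+
  have "psd_matrix n G"
    unfolding psd_matrix_def
  proof
    fix c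
    have "(\<Sum>i<Suc n. \<Sum>j<Suc n. cnj ((c(n := 0)) i) * (c(n := 0)) j * G i j) \<in> \<real>\<^sub>\<ge>\<^sub>0"
      by (rule Suc.prems(2)[unfolded psd_matrix_def, rule_format])
    then show "(\<Sum>i<n. \<Sum>j<n. cnj (c i) * c j * G i j) \<in> \<real>\<^sub>\<ge>\<^sub>0" by simp
  qed
  then have "(\<Sum>i<n. \<Sum>j<n. s' (v i) (v j) * G i j) \<in> \<real>\<^sub>\<ge>\<^sub>0"
    unfolding s'_def by (intro Suc.IH semi_inner_complement)
  then have 1: "(\<Sum>i<Suc n. \<Sum>j<Suc n. s' (v i) (v j) * G i j) \<in> \<real>\<^sub>\<ge>\<^sub>0" by (simp add: s'_0)
  \<comment> \<open>The rank-one part: \<open>G\<close> is evaluated at the vector \<open>c j = s (v n) (v j)\<close>.\<close>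
  have "(\<Sum>i<Suc n. \<Sum>j<Suc n. cnj (s (v n) (v i)) * s (v n) (v j) * G i j) \<in> \<real>\<^sub>\<ge>\<^sub>0"
    by (rule Suc.prems(2)[unfolded psd_matrix_def, rule_format])
  then have "(\<Sum>i<Suc n. \<Sum>j<Suc n. cnj (s (v n) (v i)) * s (v n) (v j) * G i j) / s (v n) (v n) \<in> \<real>\<^sub>\<ge>\<^sub>0"
    by (rule nonneg_Reals_divide_I) (simp add: s_self)
  with 1 have "(\<Sum>i<Suc n. \<Sum>j<Suc n. s' (v i) (v j) * G i j)
      + (\<Sum>i<Suc n. \<Sum>j<Suc n. cnj (s (v n) (v i)) * s (v n) (v j) * G i j) / s (v n) (v n) \<in> \<real>\<^sub>\<ge>\<^sub>0"
    by (rule nonneg_Reals_add_I)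
  also have "(\<Sum>i<Suc n. \<Sum>j<Suc n. s' (v i) (v j) * G i j)
      + (\<Sum>i<Suc n. \<Sum>j<Suc n. cnj (s (v n) (v i)) * s (v n) (v j) * G i j) / s (v n) (v n)
      = (\<Sum>i<Suc n. \<Sum>j<Suc n. s (v i) (v j) * G i j)"
    unfolding sum_divide_distrib sum.distrib[symmetric] s'_def s_commute[symmetric]
    by (intro sum.cong refl) (simp add: algebra_simps)
  finally show ?case .
qed simp

section \<open>Operator-valued positive kernels\<close>

lemma op_matrix_positive_iff:
  "op_matrix_positive n T \<longleftrightarrow> (\<forall>h. (\<Sum>i<n. \<Sum>j<n. cinner (h i) (T i j (h j))) \<in> \<real>\<^sub>\<ge>\<^sub>0)"
  by (simp add: op_matrix_positive_def cinner_sum_right)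

text \<open>An operator-valued kernel \<open>K\<close> all of whose finite matrices are positive. It induces a semi-inner
  product on the finite sums \<open>\<Sum> x \<otimes> h\<close>.\<close>

locale positive_kernel =
  fixes K :: "'i \<Rightarrow> 'i \<Rightarrow> ('h::complex_inner \<Rightarrow>\<^sub>L 'h)"
  assumes bounded: "K x y \<in> bounded_ops"
    and positive: "op_matrix_positive n (\<lambda>i j. K (z i) (z j))"
begin

lemma hermitian: "cinner h (K x y k) = cnj (cinner k (K y x h))"
proof -
  have q: "cinner h (K x x h) + cinner h (K x y k) + (cinner k (K y x h) + cinner k (K y y k)) \<in> \<real>\<^sub>\<ge>\<^sub>0"
    for h k
  proof -
    have "(\<Sum>i<2. \<Sum>j<2. cinner ((if i = 0 then h else k))
        (K (if i = (0::nat) then x else y) (if j = (0::nat) then x else y) (if j = 0 then h else k))) \<in> \<real>\<^sub>\<ge>\<^sub>0"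
      using positive[of 2 "\<lambda>i. if i = 0 then x else y"] unfolding op_matrix_positive_iff
      by (rule spec)
    then show ?thesis by (simp add: numeral_2_eq_2)
  qed
  \<comment> \<open>Quadratic forms with real values are hermitian, by polarization.\<close>
  have im: "Im (cinner h (K x y k)) = - Im (cinner k (K y x h))" for h k
    using q[of h k] q[of h 0] q[of 0 k] by (simp add: blinfun.zero_right complex_nonneg_Reals_iff)
  have "Re (cinner h (K x y k)) = Re (cinner k (K y x h))"
    using im[of h "\<i> *\<^sub>C k"] bounded[of x y]
    by (simp add: bounded_ops_iff cinner_scaleC_right cinner_scaleC_left)
  with im[of h k] show ?thesis by (simp add: complex_eq_iff)
qed

text \<open>The semi-inner product \<open>\<langle>x \<otimes> h, y \<otimes> k\<rangle> = \<langle>h, K(x, y) k\<rangle>\<close>, where a list of pairs \<open>(x, h)\<close> stands for the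
  sum of the elementary tensors \<open>x \<otimes> h\<close>.\<close>

definition gram :: "('i \<times> 'h) list \<Rightarrow> ('i \<times> 'h) list \<Rightarrow> complex"
  where "gram p q = (\<Sum>(x, h)\<leftarrow>p. \<Sum>(y, k)\<leftarrow>q. cinner h (K x y k))"

abbreviation scale_list :: "complex \<Rightarrow> ('i \<times> 'h) list \<Rightarrow> ('i \<times> 'h) list"
  where "scale_list c \<equiv> map (\<lambda>(x, h). (x, c *\<^sub>C h))"

lemma gram_Nil [simp]: "gram [] q = 0" "gram p [] = 0"
  by (simp_all add: gram_def case_prod_unfold sum_list_0)

lemma gram_append_left: "gram (p @ p') q = gram p q + gram p' q"
  by (simp add: gram_def)

lemma gram_append_right: "gram p (q @ q') = gram p q + gram p q'"
  by (simp add: gram_def case_prod_unfold sum_list_addf)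

lemma gram_single: "gram [(x, h)] [(y, k)] = cinner h (K x y k)"
  by (simp add: gram_def)

lemma gram_Cons_left: "gram (xh # p) q = gram [xh] q + gram p q"
  using gram_append_left[of "[xh]" p q] by simp

lemma gram_Cons_right: "gram p (xh # q) = gram p [xh] + gram p q"
  using gram_append_right[of p "[xh]" q] by simp

lemma gram_scale: "gram p (scale_list c q) = c * gram p q"
proof (induction p)
  case (Cons a p)
  obtain x h where a: "a = (x, h)" by fastforce
  have "gram [a] (scale_list c q) = c * gram [a] q"
  proof (induction q)
    case (Cons b q)
    obtain y k where b: "b = (y, k)" by fastforce
    have "gram [a] [(y, c *\<^sub>C k)] = c * gram [a] [b]"
      using bounded[of x y] by (simp add: a b gram_single bounded_ops_iff cinner_scaleC_right)
    then show ?case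
      using Cons gram_Cons_right[of "[a]" b q] gram_Cons_right[of "[a]" "(y, c *\<^sub>C k)" "scale_list c q"]
      by (simp add: b distrib_left)
  qed simp
  then show ?case
    using Cons gram_Cons_left[of a p] by (simp add: distrib_left)
qed simp

lemma gram_eq_sum:
  "gram p q = (\<Sum>i<length p. \<Sum>j<length q. cinner (snd (p ! i)) (K (fst (p ! i)) (fst (q ! j)) (snd (q ! j))))"
  by (simp add: gram_def case_prod_unfold sum_list_sum_nth atLeast0LessThan)

lemma gram_commute: "gram p q = cnj (gram q p)"
  unfolding gram_eq_sum
  by (subst sum.swap) (simp add: hermitian[symmetric])

lemma gram_nonneg: "gram p p \<in> \<real>\<^sub>\<ge>\<^sub>0"
  unfolding gram_eq_sum
  by (rule positive[of "length p" "\<lambda>i. fst (p ! i)", unfolded op_matrix_positive_iff, rule_format])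

sublocale list: semi_inner "(@)" scale_list gram
proof
  show "0 \<le> Re (gram p p)" for p using gram_nonneg[of p] by (simp add: complex_nonneg_Reals_iff)
qed (rule gram_append_right gram_scale gram_commute)+

lemma gram_concat_left: "gram (concat (map f [0..<n])) q = (\<Sum>i<n. gram (f i) q)"
  by (induction n) (simp_all add: gram_append_left)

lemma gram_concat_right: "gram p (concat (map f [0..<n])) = (\<Sum>i<n. gram p (f i))"
  by (induction n) (simp_all add: gram_append_right)

lemma gram_sum_nonneg: "(\<Sum>i<n. \<Sum>j<n::nat. gram (f i) (f j)) \<in> \<real>\<^sub>\<ge>\<^sub>0"
  using gram_nonneg[of "concat (map f [0..<n])"] unfolding gram_concat_left unfolding gram_concat_right .

end

section \<open>Adjointable operators on a Hilbert module\<close>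

context hilbert_module
begin

lemma ip_add_left: "ip (x + y) z = ip x z + ip y z"
proof -
  have "star (ip z (x + y)) = star (ip z x) + star (ip z y)" by (simp add: ip_add_right star_add)
  then show ?thesis by (simp add: ip_star)
qed

lemma ip_scaleC_left: "ip (c *\<^sub>C x) y = cnj c *\<^sub>C ip x y"
proof -
  have "star (ip y (c *\<^sub>C x)) = cnj c *\<^sub>C star (ip y x)" by (simp add: ip_scaleC_right star_scaleC)
  then show ?thesis by (simp add: ip_star)
qed

lemma ip_act_left: "ip (act x a) y = star a * ip x y"
proof -
  have "star (ip y (act x a)) = star a * star (ip y x)" by (simp add: ip_act_right star_mult)
  then show ?thesis by (simp add: ip_star)
qed

lemma ip_minus_right: "ip x (- y) = - ip x y"
  using ip_scaleC_right[of x "-1" y] by (simp add: complex_vector.scale_minus_left scaleC_one)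

lemma ip_minus_left: "ip (- x) y = - ip x y"
  using ip_scaleC_left[of "-1" x y] by (simp add: complex_vector.scale_minus_left scaleC_one)

lemma ip_diff_right: "ip x (y - z) = ip x y - ip x z"
  using ip_add_right[of x y "- z"] by (simp add: ip_minus_right)

lemma ip_diff_left: "ip (x - y) z = ip x z - ip y z"
  using ip_add_left[of x "- y" z] by (simp add: ip_minus_left)

lemma ip_zero_right [simp]: "ip x 0 = 0"
  using ip_diff_right[of x 0 0] by simp

lemma ip_zero_left [simp]: "ip 0 x = 0"
  using ip_diff_left[of 0 0 x] by simp

lemma ip_sum_right: "ip x (\<Sum>i\<in>I. f i) = (\<Sum>i\<in>I. ip x (f i))"
  by (induction I rule: infinite_finite_induct) (simp_all add: ip_add_right)

lemma ip_sum_left: "ip (\<Sum>i\<in>I. f i) x = (\<Sum>i\<in>I. ip (f i) x)"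
  by (induction I rule: infinite_finite_induct) (simp_all add: ip_add_left)

lemma norm_ip_self: "norm (ip x x) = (norm x)\<^sup>2"
  by (simp add: norm_ip)

lemma ip_eqI:
  assumes "\<And>z. ip z x = ip z y"
  shows "x = y"
proof -
  have "ip (x - y) (x - y) = 0" by (simp only: ip_diff_right[of "x - y"]) (simp add: assms)
  then show ?thesis using ip_definite by fastforce
qed

lemma polarization:
  "4 *\<^sub>R ip x y = ip (x + y) (x + y) - ip (x - y) (x - y)
    + \<i> *\<^sub>C (ip (\<i> *\<^sub>C x + y) (\<i> *\<^sub>C x + y) - ip (\<i> *\<^sub>C x - y) (\<i> *\<^sub>C x - y))"
proof -
  have 1: "ip (x + y) (x + y) - ip (x - y) (x - y) = 2 *\<^sub>R (ip x y + ip y x)"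
    by (simp add: ip_add_left ip_add_right ip_diff_left ip_diff_right algebra_simps scaleR_2)
  have 2: "ip (\<i> *\<^sub>C x + y) (\<i> *\<^sub>C x + y) - ip (\<i> *\<^sub>C x - y) (\<i> *\<^sub>C x - y)
      = 2 *\<^sub>R (ip (\<i> *\<^sub>C x) y + ip y (\<i> *\<^sub>C x))"
    by (simp add: ip_add_left ip_add_right ip_diff_left ip_diff_right algebra_simps scaleR_2)
  have 3: "\<i> *\<^sub>C 2 *\<^sub>R (ip (\<i> *\<^sub>C x) y + ip y (\<i> *\<^sub>C x)) = 2 *\<^sub>R (ip x y - ip y x)"
    by (simp add: ip_scaleC_left ip_scaleC_right scaleR_2 complex_vector.scale_right_distrib
        complex_vector.scale_minus_left scaleC_scaleC algebra_simps scaleC_one)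
  have 4: "4 *\<^sub>R ip x y = 2 *\<^sub>R (2 *\<^sub>R ip x y)" by simp
  show ?thesis unfolding 1 2 3 unfolding 4 scaleR_2 by simp
qed

text \<open>A form of the Cauchy--Schwarz inequality with a constant that is not optimal; it follows from
  polarization, without the order on \<open>\<A>\<close>.\<close>

lemma norm_ip_le: "norm (ip x y) \<le> 4 * norm x * norm y"
proof (cases "x = 0 \<or> y = 0")
  case False
  have sq: "norm (ip (u + v) (u + v)) \<le> 4" "norm (ip (u - v) (u - v)) \<le> 4"
    if "norm u = 1" "norm v = 1" for u v
  proof -
    have "norm (u + v) \<le> 2" "norm (u - v) \<le> 2"
      using norm_triangle_ineq[of u v] norm_triangle_ineq4[of u v] that by auto
    then have "(norm (u + v))\<^sup>2 \<le> 2\<^sup>2" "(norm (u - v))\<^sup>2 \<le> 2\<^sup>2" by (intro power_mono; simp)+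
    then show "norm (ip (u + v) (u + v)) \<le> 4" "norm (ip (u - v) (u - v)) \<le> 4"
      by (simp_all add: norm_ip_self)
  qed
  have unit: "norm (ip u v) \<le> 4" if uv: "norm u = 1" "norm v = 1" for u v
  proof -
    have iu: "norm (\<i> *\<^sub>C u) = 1" using uv by (simp add: norm_scaleC)
    let ?d = "ip (\<i> *\<^sub>C u + v) (\<i> *\<^sub>C u + v) - ip (\<i> *\<^sub>C u - v) (\<i> *\<^sub>C u - v)"
    have "norm (4 *\<^sub>R ip u v) \<le> norm (ip (u + v) (u + v) - ip (u - v) (u - v)) + norm (\<i> *\<^sub>C ?d)"
      unfolding polarization by (rule norm_triangle_ineq)
    also have "norm (ip (u + v) (u + v) - ip (u - v) (u - v)) \<le> 8"
      using norm_triangle_ineq4 sq[OF uv] by (smt (verit))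
    also have "norm (\<i> *\<^sub>C ?d) \<le> 8"
      using norm_triangle_ineq4[of "ip (\<i> *\<^sub>C u + v) (\<i> *\<^sub>C u + v)"] sq[OF iu uv(2)]
      by (simp add: norm_scaleC) (smt (verit))
    finally show ?thesis by simp
  qed
  define u v where "u = (1 / norm x) *\<^sub>R x" and "v = (1 / norm y) *\<^sub>R y"
  have "norm u = 1" "norm v = 1" using False by (simp_all add: u_def v_def)
  then have "norm (ip u v) \<le> 4" by (rule unit)
  moreover have "ip u v = (1 / (norm x * norm y)) *\<^sub>R ip x y"
    by (simp add: u_def v_def scaleR_scaleC ip_scaleC_left ip_scaleC_right scaleC_scaleC mult.commute)
  ultimately show ?thesis using False by (simp add: field_simps)
qed auto

lemma bounded_bilinear_ip: "bounded_bilinear ip"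
proof
  show "\<exists>K. \<forall>a b. norm (ip a b) \<le> norm a * norm b * K"
    using norm_ip_le by (intro exI[of _ 4]) (simp add: mult_ac)
qed (simp_all add: ip_add_left ip_add_right scaleR_scaleC ip_scaleC_left ip_scaleC_right)

lemma norm_act_le: "norm (act x a) \<le> norm x * norm a"
proof -
  have "(norm (act x a))\<^sup>2 = norm (star a * (ip x x * a))"
    by (simp add: norm_ip_self[symmetric] ip_act_left ip_act_right mult.assoc)
  also have "\<dots> \<le> norm a * ((norm x)\<^sup>2 * norm a)"
    using norm_mult_ineq[of "star a" "ip x x * a"] norm_mult_ineq[of "ip x x" a]
    by (metis (no_types, opaque_lifting) dual_order.trans mult_left_mono norm_ge_zero norm_ip_self norm_star)
  finally have "(norm (act x a))\<^sup>2 \<le> (norm x * norm a)\<^sup>2"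
    by (simp add: power2_eq_square mult_ac)
  then show ?thesis by (rule power2_le_imp_le) simp
qed

lemma rank_one_apply: "blinfun_apply (rank_one act ip x y) z = act x (ip y z)"
proof -
  have "bounded_linear (\<lambda>z. act x (ip y z))"
  proof (rule bounded_linear_intro[where K = "4 * norm x * norm y"])
    show "norm (act x (ip y z)) \<le> norm z * (4 * norm x * norm y)" for z
      using norm_act_le[of x "ip y z"] mult_left_mono[OF norm_ip_le[of y z], of "norm x"]
      by (simp add: mult_ac)
  qed (simp_all add: ip_add_right act_add_right scaleR_scaleC ip_scaleC_right act_scaleC_right)
  then show ?thesis by (simp add: rank_one_def bounded_linear_Blinfun_apply)
qed

text \<open>\<open>v\<close> is the adjoint of \<open>u\<close> with respect to the module inner product.\<close>

definition adjoint_pair :: "('e \<Rightarrow>\<^sub>L 'e) \<Rightarrow> ('e \<Rightarrow>\<^sub>L 'e) \<Rightarrow> bool"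
  where "adjoint_pair u v \<longleftrightarrow> (\<forall>x y. ip (v x) y = ip x (u y))"

lemma adjoint_pair_sym: "adjoint_pair u v \<Longrightarrow> adjoint_pair v u"
  unfolding adjoint_pair_def by (metis ip_star)

lemma adjoint_pair_unique: "adjoint_pair u v \<Longrightarrow> adjoint_pair u w \<Longrightarrow> v = w"
  using adjoint_pair_sym[of u v] adjoint_pair_sym[of u w]
  by (intro blinfun_eqI ip_eqI) (metis adjoint_pair_def)

lemma module_adj_eq: "adjoint_pair u v \<Longrightarrow> module_adj ip u = v"
  unfolding module_adj_def
  by (rule the_equality) (auto simp: adjoint_pair_def[symmetric] intro: adjoint_pair_unique)

text \<open>The operators that have an adjoint. They contain \<open>\<K>\<^sub>1(\<E>)\<close>, and they are visibly closed under sums,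
  products and adjoints.\<close>

definition adjointable :: "('e \<Rightarrow>\<^sub>L 'e) set"
  where "adjointable = {u. \<exists>v. adjoint_pair u v}"

lemma adjoint_pair_module_adj: "u \<in> adjointable \<Longrightarrow> adjoint_pair u (module_adj ip u)"
  by (auto simp: adjointable_def module_adj_eq)

lemma module_adj_adjointable: "u \<in> adjointable \<Longrightarrow> module_adj ip u \<in> adjointable"
  using adjoint_pair_module_adj adjoint_pair_sym unfolding adjointable_def by blast

lemma module_adj_module_adj: "u \<in> adjointable \<Longrightarrow> module_adj ip (module_adj ip u) = u"
  by (rule module_adj_eq[OF adjoint_pair_sym[OF adjoint_pair_module_adj]])

lemma ip_module_adj: "u \<in> adjointable \<Longrightarrow> ip (module_adj ip u x) y = ip x (u y)"
  using adjoint_pair_module_adj[of u] by (simp add: adjoint_pair_def)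

lemma adjoint_pair_add: "adjoint_pair u v \<Longrightarrow> adjoint_pair u' v' \<Longrightarrow> adjoint_pair (u + u') (v + v')"
  by (simp add: adjoint_pair_def blinfun.add_left ip_add_left ip_add_right)

lemma adjoint_pair_scaleC: "adjoint_pair u v \<Longrightarrow> adjoint_pair (c *\<^sub>C u) (cnj c *\<^sub>C v)"
  by (simp add: adjoint_pair_def scaleC_blinfun_apply ip_scaleC_left ip_scaleC_right)

lemma adjoint_pair_compose: "adjoint_pair u v \<Longrightarrow> adjoint_pair u' v' \<Longrightarrow> adjoint_pair (u o\<^sub>L u') (v' o\<^sub>L v)"
  by (simp add: adjoint_pair_def)

lemma adjoint_pair_id: "adjoint_pair id_blinfun id_blinfun"
  by (simp add: adjoint_pair_def)

lemma adjoint_pair_rank_one: "adjoint_pair (rank_one act ip x y) (rank_one act ip y x)"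
  by (simp add: adjoint_pair_def rank_one_apply ip_act_left ip_act_right ip_star)

lemma adjointable_add: "u \<in> adjointable \<Longrightarrow> v \<in> adjointable \<Longrightarrow> u + v \<in> adjointable"
  unfolding adjointable_def using adjoint_pair_add by blast

lemma adjointable_scaleC: "u \<in> adjointable \<Longrightarrow> c *\<^sub>C u \<in> adjointable"
  unfolding adjointable_def using adjoint_pair_scaleC by blast

lemma adjointable_compose: "u \<in> adjointable \<Longrightarrow> v \<in> adjointable \<Longrightarrow> u o\<^sub>L v \<in> adjointable"
  unfolding adjointable_def using adjoint_pair_compose by blast

lemma adjointable_id: "id_blinfun \<in> adjointable"
  unfolding adjointable_def using adjoint_pair_id by blast

lemma adjointable_rank_one: "rank_one act ip x y \<in> adjointable"
  unfolding adjointable_def using adjoint_pair_rank_one by blast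

lemma adjointable_sum: "(\<And>i. i \<in> I \<Longrightarrow> f i \<in> adjointable) \<Longrightarrow> (\<Sum>i\<in>I. f i) \<in> adjointable"
  using adjointable_scaleC[OF adjointable_id, of 0]
  by (induction I rule: infinite_finite_induct) (auto intro: adjointable_add)

lemma norm_adjoint_le:
  assumes "adjoint_pair u v"
  shows "norm v \<le> 4 * norm u"
proof (rule norm_blinfun_bound)
  fix y
  have "(norm (v y))\<^sup>2 = norm (ip (v y) (v y))" by (simp add: norm_ip_self)
  also have "\<dots> = norm (ip y (u (v y)))" using assms by (simp add: adjoint_pair_def)
  also have "\<dots> \<le> 4 * norm y * norm (u (v y))" by (rule norm_ip_le)
  also have "\<dots> \<le> 4 * norm y * (norm u * norm (v y))" by (intro mult_left_mono norm_blinfun) simp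
  finally have "norm (v y) * norm (v y) \<le> (4 * norm u * norm y) * norm (v y)"
    by (simp add: power2_eq_square mult_ac)
  then show "norm (v y) \<le> 4 * norm u * norm y" by (cases "v y = 0") auto
qed simp

lemma closed_adjointable: "closed adjointable"
  unfolding closed_sequential_limits
proof (intro allI impI, elim conjE)
  fix f u assume f: "\<forall>n. f n \<in> adjointable" and lim: "f \<longlonglongrightarrow> u"
  define g where "g n = module_adj ip (f n)" for n
  have fg: "adjoint_pair (f n) (g n)" for n using f by (simp add: g_def adjoint_pair_module_adj)
  have le: "norm (g m - g n) \<le> 4 * norm (f m - f n)" for m n
  proof (rule norm_adjoint_le)
    show "adjoint_pair (f m - f n) (g m - g n)"
      using fg by (simp add: adjoint_pair_def blinfun.diff_left ip_diff_left ip_diff_right)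
  qed
  have "Cauchy g"
  proof (rule metric_CauchyI)
    fix e :: real assume "0 < e"
    then obtain M where M: "\<And>m n. m \<ge> M \<Longrightarrow> n \<ge> M \<Longrightarrow> dist (f m) (f n) < e / 4"
      using LIMSEQ_imp_Cauchy[OF lim] unfolding Cauchy_def by (metis divide_pos_pos zero_less_numeral)
    have "dist (g m) (g n) < e" if "m \<ge> M" "n \<ge> M" for m n
      using le[of m n] M[OF that] by (simp add: dist_norm)
    then show "\<exists>M. \<forall>m\<ge>M. \<forall>n\<ge>M. dist (g m) (g n) < e" by blast
  qed
  then obtain v where v: "g \<longlonglongrightarrow> v" by (auto simp: Cauchy_convergent_iff convergent_def)
  have "ip (v x) y = ip x (u y)" for x y
  proof (rule LIMSEQ_unique)
    show "(\<lambda>n. ip (g n x) y) \<longlonglongrightarrow> ip (v x) y"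
      by (intro bounded_bilinear.tendsto[OF bounded_bilinear_ip] blinfun.tendsto v tendsto_const)
    have "(\<lambda>n. ip x (f n y)) \<longlonglongrightarrow> ip x (u y)"
      by (intro bounded_bilinear.tendsto[OF bounded_bilinear_ip] blinfun.tendsto lim tendsto_const)
    then show "(\<lambda>n. ip (g n x) y) \<longlonglongrightarrow> ip x (u y)" using fg by (simp add: adjoint_pair_def)
  qed
  then show "u \<in> adjointable" unfolding adjointable_def adjoint_pair_def by blast
qed

lemma K1_subset_adjointable: "alg_carrier (K1 act ip) \<subseteq> adjointable"
proof -
  have "cspan {rank_one act ip x y | x y. True} \<subseteq> adjointable"
  proof (rule complex_vector.span_minimal)
    show "complex_vector.subspace adjointable"
      using adjointable_scaleC[OF adjointable_id, of 0]
      by (auto simp: complex_vector.subspace_def intro: adjointable_add adjointable_scaleC)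
  qed (auto intro: adjointable_rank_one)
  then have "compact_ops act ip \<subseteq> adjointable"
    unfolding compact_ops_def by (rule closure_minimal[OF _ closed_adjointable])
  then show ?thesis
    by (auto simp: K1_def intro!: adjointable_add adjointable_scaleC adjointable_id)
qed

text \<open>\<open>u\<^sup>*u \<le> M\<close>, witnessed by \<open>M - u\<^sup>*u = M c\<^sup>*c\<close>.\<close>

lemma adjointable_dominated:
  assumes u: "u \<in> adjointable"
  obtains M :: real and c :: "'e \<Rightarrow>\<^sub>L 'e"
  where "0 < M" "\<And>x y. ip (u x) (u y) = M *\<^sub>R (ip x y - ip (c x) (c y))"
proof -
  define w where "w = module_adj ip u o\<^sub>L u"
  have w: "ip (w x) y = ip x (w y)" "ip (u x) (u y) = ip x (w y)" for x y
    using ip_module_adj[OF u] ip_module_adj[OF module_adj_adjointable[OF u]] module_adj_module_adj[OF u]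
    by (simp_all add: w_def)
  define M where "M = norm w + 1"
  have M: "0 < M" "norm w \<le> M" by (simp_all add: M_def add_pos_nonneg add_nonneg_pos)
  define x0 where "x0 = (1 / M) *\<^sub>R w"
  have nx0: "norm x0 \<le> 1" using M by (simp add: x0_def)
  define S where "S = {z :: 'e \<Rightarrow>\<^sub>L 'e. \<forall>x y. ip (z x) y = ip x (z y)}"
  have cl: "closed S"
    unfolding S_def
    by (intro closed_Collect_all closed_Collect_eq bounded_bilinear.continuous_on[OF bounded_bilinear_ip]
        blinfun.continuous_on continuous_on_const continuous_on_id)
  have zero: "0 \<in> S" by (simp add: S_def)
  have step: "(1/2) *\<^sub>R (x0 + (z o\<^sub>L z)) \<in> S" if "z \<in> S" for z
    using that w(1) by (simp add: S_def x0_def blinfun.scaleR_left blinfun.add_left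
        scaleR_scaleC[where 'a='e] scaleR_scaleC[where 'a='a] ip_scaleC_left ip_scaleC_right ip_add_left ip_add_right)
  obtain z where z: "z \<in> S" "z = (1/2) *\<^sub>R (x0 + (z o\<^sub>L z))"
    using sqrt_iteration[OF bounded_bilinear_blinfun_compose norm_blinfun_compose nx0 cl zero step]
    by metis
  define c where "c = id_blinfun - z"
  have "ip (u x) (u y) = M *\<^sub>R (ip x y - ip (c x) (c y))" for x y
  proof -
    have "2 *\<^sub>R z y = 2 *\<^sub>R ((1/2) *\<^sub>R (x0 + (z o\<^sub>L z))) y"
      using arg_cong[OF z(2), of "\<lambda>t. 2 *\<^sub>R blinfun_apply t y"] .
    then have zz: "z (z y) = z y + z y - x0 y"
      by (simp add: blinfun.scaleR_left blinfun.add_left scaleR_2)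
    have "ip (z x) t = ip x (z t)" for t using z(1) by (simp add: S_def)
    then have "ip (c x) (c y) = ip x y - ip x (x0 y)"
      by (simp add: c_def blinfun.diff_left ip_diff_left ip_diff_right blinfun.diff_right zz ip_add_right)
    moreover have "M *\<^sub>R ip x (x0 y) = ip x (w y)"
      using M by (simp add: x0_def blinfun.scaleR_left scaleR_scaleC[where 'a='e] ip_scaleC_right scaleR_scaleC[where 'a='a] scaleC_scaleC scaleC_one)
    ultimately show ?thesis by (simp add: w(2))
  qed
  with M(1) show ?thesis using that by blast
qed

end

section \<open>Dilation of a completely semi-\<open>\<phi>\<close>-map\<close>

text \<open>The data of the theorem: a completely positive map \<open>\<phi>\<close> and a completely semi-\<open>\<phi>\<close>-map \<open>\<Phi>\<close>.\<close>

locale semi_map = hilbert_module act ip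
  for act :: "'e::cbanach \<Rightarrow> 'a::unital_cstar_algebra \<Rightarrow> 'e" and ip :: "'e \<Rightarrow> 'e \<Rightarrow> 'a" +
  fixes \<phi> :: "'a \<Rightarrow> ('h::chilbert_space \<Rightarrow>\<^sub>L 'h)" and \<Phi> :: "'e \<Rightarrow> ('h \<Rightarrow>\<^sub>L 'k::chilbert_space)"
  assumes cp: "completely_positive full_algebra \<phi>"
    and semi: "completely_semi_map ip \<phi> \<Phi>"
begin

lemma phi_bounded: "\<phi> a \<in> bounded_ops"
  and phi_add: "\<phi> (a + b) = \<phi> a + \<phi> b"
  and phi_scaleC: "\<phi> (c *\<^sub>C a) = c *\<^sub>C \<phi> a"
  and phi_positive: "matrix_positive full_algebra n X \<Longrightarrow> op_matrix_positive n (\<lambda>i j. \<phi> (X i j))"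
  using cp by (simp_all add: completely_positive_def full_algebra_def)

lemma Phi_bounded: "\<Phi> x \<in> bounded_ops"
  and Phi_clinear: "clinear \<Phi>"
  using semi by (simp_all add: completely_semi_map_def)

lemma Phi_add: "\<Phi> (x + y) = \<Phi> x + \<Phi> y"
  using Phi_clinear by (rule clinear_add)

lemma Phi_scaleC: "\<Phi> (c *\<^sub>C x) = c *\<^sub>C \<Phi> x"
  using Phi_clinear by (rule clinear_scaleC)

lemma Phi_zero: "\<Phi> 0 = 0"
  using Phi_scaleC[of 0 0] by simp

lemma phi_diff: "\<phi> (a - b) = \<phi> a - \<phi> b"
  using phi_add[of "a - b" b] by simp

lemma phi_zero: "\<phi> 0 = 0"
  using phi_diff[of 0 0] by simp

text \<open>The defining inequality for a matrix whose only nonzero row is \<open>x\<close>. It gives the positivity of the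
  kernel \<open>\<phi>(\<langle>x, y\<rangle>)\<close> and the contractivity of \<open>W\<close> at once.\<close>

lemma semi_row:
  "(\<Sum>i<n. \<Sum>j<n::nat. cinner (h i) (\<phi> (ip (x i) (x j)) (h j)))
    - cinner (\<Sum>i<n. \<Phi> (x i) (h i)) (\<Sum>j<n. \<Phi> (x j) (h j)) \<in> \<real>\<^sub>\<ge>\<^sub>0"
proof (cases n)
  case (Suc m)
  let ?x = "\<lambda>k i. if k = (0::nat) then x i else 0"
  have 1: "(\<Sum>k<n. ip (?x k i) (?x k j)) = ip (x i) (x j)" for i j
  proof -
    have "(\<Sum>k<n. ip (?x k i) (?x k j)) = (\<Sum>k<n. if k = 0 then ip (x i) (x j) else 0)"
      by (intro sum.cong) auto
    then show ?thesis by (simp add: Suc)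
  qed
  have 2: "(\<Sum>k<n. hilbert_adj (\<Phi> (?x k i)) o\<^sub>L \<Phi> (?x k j)) = hilbert_adj (\<Phi> (x i)) o\<^sub>L \<Phi> (x j)" for i j
  proof -
    have "(\<Sum>k<n. hilbert_adj (\<Phi> (?x k i)) o\<^sub>L \<Phi> (?x k j))
        = (\<Sum>k<n. if k = 0 then hilbert_adj (\<Phi> (x i)) o\<^sub>L \<Phi> (x j) else 0)"
      by (intro sum.cong refl blinfun_eqI) (simp add: Phi_zero blinfun.zero_right)
    then show ?thesis by (simp add: Suc)
  qed
  have "op_matrix_positive n (\<lambda>i j. \<phi> (ip (x i) (x j)) - (hilbert_adj (\<Phi> (x i)) o\<^sub>L \<Phi> (x j)))"
  proof -
    have "op_matrix_le n (\<lambda>i j. \<Sum>k<n. hilbert_adj (\<Phi> (?x k i)) o\<^sub>L \<Phi> (?x k j))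
        (\<lambda>i j. \<phi> (\<Sum>k<n. ip (?x k i) (?x k j)))"
      by (rule semi[unfolded completely_semi_map_def, THEN conjunct2, THEN conjunct2, rule_format])
    then show ?thesis unfolding 1 2 op_matrix_le_def .
  qed
  then have "(\<Sum>i<n. \<Sum>j<n. cinner (h i) ((\<phi> (ip (x i) (x j)) - (hilbert_adj (\<Phi> (x i)) o\<^sub>L \<Phi> (x j))) (h j))) \<in> \<real>\<^sub>\<ge>\<^sub>0"
    unfolding op_matrix_positive_iff by blast
  also have "(\<Sum>i<n. \<Sum>j<n. cinner (h i) ((\<phi> (ip (x i) (x j)) - (hilbert_adj (\<Phi> (x i)) o\<^sub>L \<Phi> (x j))) (h j)))
    = (\<Sum>i<n. \<Sum>j<n. cinner (h i) (\<phi> (ip (x i) (x j)) (h j)))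
      - (\<Sum>i<n. \<Sum>j<n. cinner (\<Phi> (x i) (h i)) (\<Phi> (x j) (h j)))"
    by (simp add: blinfun.diff_left cinner_diff_right sum_subtractf hilbert_adj(2)[OF Phi_bounded])
  finally show ?thesis unfolding cinner_sum_left unfolding cinner_sum_right .
qed simp

sublocale E: positive_kernel "\<lambda>x y. \<phi> (ip x y)"
proof
  fix n and z :: "nat \<Rightarrow> 'e"
  show "op_matrix_positive n (\<lambda>i j. \<phi> (ip (z i) (z j)))"
    unfolding op_matrix_positive_iff
  proof
    fix h :: "nat \<Rightarrow> 'h"
    let ?w = "\<Sum>i<n. \<Phi> (z i) (h i)"
    have "cinner ?w ?w \<in> \<real>\<^sub>\<ge>\<^sub>0" by (rule cinner_self_nonneg)
    from nonneg_Reals_add_I[OF semi_row[of h z n] this]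
    show "(\<Sum>i<n. \<Sum>j<n. cinner (h i) (\<phi> (ip (z i) (z j)) (h j))) \<in> \<real>\<^sub>\<ge>\<^sub>0" by simp
  qed
qed (rule phi_bounded)

text \<open>The kernel \<open>\<phi>(a\<^sup>*b)\<close> on \<open>\<A>\<close>, whose form is that of the Stinespring dilation of \<open>\<phi>\<close>.\<close>

sublocale A: positive_kernel "\<lambda>a b. \<phi> (star a * b)"
proof
  fix n and z :: "nat \<Rightarrow> 'a"
  show "op_matrix_positive n (\<lambda>i j. \<phi> (star (z i) * z j))"
  proof (rule phi_positive)
    show "matrix_positive full_algebra n (\<lambda>i j. star (z i) * z j)"
      unfolding matrix_positive_def
    proof (intro exI conjI allI impI)
      fix i j assume ij: "i < n" "j < n"
      have "(\<Sum>k<n. star (if k = 0 then z i else 0) * (if k = 0 then z j else 0))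
          = (\<Sum>k<n. if k = 0 then star (z i) * z j else 0)"
        by (intro sum.cong) auto
      then show "star (z i) * z j = (\<Sum>k<n. alg_mult full_algebra
          (alg_star full_algebra (if k = (0::nat) then z i else 0)) (if k = 0 then z j else 0))"
        using ij by (simp add: full_algebra_def)
    qed (simp add: full_algebra_def)
  qed
qed (rule phi_bounded)

text \<open>The contraction \<open>x \<otimes> h \<mapsto> \<Phi>(x) h\<close> from \<open>\<E> \<otimes> H\<^sub>1\<close> to \<open>H\<^sub>2\<close>.\<close>

definition W :: "('e \<times> 'h) list \<Rightarrow> 'k" where "W p = (\<Sum>(x, h)\<leftarrow>p. \<Phi> x h)"

lemma W_append: "W (p @ q) = W p + W q"
  by (simp add: W_def)

lemma W_single: "W [(x, h)] = \<Phi> x h"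
  by (simp add: W_def)

lemma W_scale: "W (E.scale_list c p) = c *\<^sub>C W p"
proof (induction p)
  case (Cons a p)
  then show ?case
    using Phi_bounded[of "fst a"]
    by (auto simp: W_def bounded_ops_iff complex_vector.scale_right_distrib split: prod.splits)
qed (simp add: W_def)

lemma norm_W_le: "norm (W p) \<le> E.list.nrm p"
proof -
  have W: "W p = (\<Sum>i<length p. \<Phi> (fst (p ! i)) (snd (p ! i)))"
    by (simp add: W_def case_prod_unfold sum_list_sum_nth atLeast0LessThan)
  have "E.gram p p - cinner (W p) (W p) \<in> \<real>\<^sub>\<ge>\<^sub>0"
    using semi_row[of "\<lambda>i. snd (p ! i)" "\<lambda>i. fst (p ! i)" "length p"]
    unfolding E.gram_eq_sum W .
  then have "(norm (W p))\<^sup>2 \<le> (E.list.nrm p)\<^sup>2"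
    by (simp add: complex_nonneg_Reals_iff hilbert.nrm_sq E.list.nrm_sq)
  then show ?thesis by (rule power2_le_imp_le) simp
qed

lemma W_diff: "W (E.list.diff p q) = W p - W q"
  using W_scale[of "-1" q]
  by (simp add: E.list.diff_def W_append complex_vector.scale_minus_left scaleC_one)

text \<open>The representation \<open>\<rho>(u)\<close> of operators on \<open>\<E>\<close> by \<open>x \<otimes> h \<mapsto> u x \<otimes> h\<close>.\<close>

definition app :: "('e \<Rightarrow>\<^sub>L 'e) \<Rightarrow> ('e \<times> 'h) list \<Rightarrow> ('e \<times> 'h) list"
  where "app u = map (\<lambda>(x, h). (u x, h))"

lemma app_diff: "app u (E.list.diff p q) = E.list.diff (app u p) (app u q)"
  unfolding app_def E.list.diff_def by (simp add: case_prod_unfold comp_def)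

lemma app_id: "app id_blinfun p = p"
  by (simp add: app_def)

lemma gram_app_eq_sum:
  "E.gram (app u p) (app v q) = (\<Sum>i<length p. \<Sum>j<length q.
    cinner (snd (p ! i)) (\<phi> (ip (u (fst (p ! i))) (v (fst (q ! j)))) (snd (q ! j))))"
  by (simp add: E.gram_eq_sum app_def case_prod_unfold)

lemma gram_app_right:
  "E.gram p (app v q) = (\<Sum>i<length p. \<Sum>j<length q.
    cinner (snd (p ! i)) (\<phi> (ip (fst (p ! i)) (v (fst (q ! j)))) (snd (q ! j))))"
  using gram_app_eq_sum[of id_blinfun p v q] by (simp add: app_id)

lemma gram_app_adjoint:
  assumes "adjoint_pair u v"
  shows "E.gram (app v p) (app w q) = E.gram p (app (u o\<^sub>L w) q)"
  unfolding gram_app_eq_sum unfolding gram_app_right using assms by (simp add: adjoint_pair_def)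

lemma gram_app_adjoint':
  assumes "adjoint_pair u v"
  shows "E.gram (app v p) q = E.gram p (app u q)"
proof -
  have "u o\<^sub>L id_blinfun = u" by (rule blinfun_eqI) simp
  then show ?thesis using gram_app_adjoint[OF assms, of p id_blinfun q] by (simp add: app_id)
qed

lemma gram_app_add: "E.gram p (app (u + v) q) = E.gram p (app u q) + E.gram p (app v q)"
  by (simp add: gram_app_right blinfun.add_left ip_add_right phi_add cinner_add_right sum.distrib)

lemma W_app_add: "W (app (u + v) p) = W (app u p) + W (app v p)"
  by (induction p) (auto simp: W_def app_def blinfun.add_left Phi_add algebra_simps)

lemma W_app_scaleC: "W (app (c *\<^sub>C u) p) = c *\<^sub>C W (app u p)"
  by (induction p)
    (auto simp: W_def app_def scaleC_blinfun_apply Phi_scaleC complex_vector.scale_right_distrib)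

lemma app_bounded:
  assumes "u \<in> adjointable"
  obtains C where "0 \<le> C" "\<And>p. E.list.nrm (app u p) \<le> C * E.list.nrm p"
proof -
  obtain M and c :: "'e \<Rightarrow>\<^sub>L 'e" where M: "0 < M" "\<And>x y. ip (u x) (u y) = M *\<^sub>R (ip x y - ip (c x) (c y))"
    using adjointable_dominated[OF assms] by metis
  have "E.list.nrm (app u p) \<le> sqrt M * E.list.nrm p" for p
  proof -
    have "E.gram (app u p) (app u p) = M * (E.gram p p - E.gram (app c p) (app c p))"
      unfolding gram_app_eq_sum E.gram_eq_sum[of p p]
      by (simp add: M(2) phi_scaleC phi_diff scaleC_blinfun_apply
          blinfun.diff_left scaleR_scaleC cinner_scaleC_right cinner_diff_right sum_subtractf
          sum_distrib_left right_diff_distrib)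
    then have "(E.list.nrm (app u p))\<^sup>2 = M * ((E.list.nrm p)\<^sup>2 - (E.list.nrm (app c p))\<^sup>2)"
      by (simp add: E.list.nrm_sq)
    also have "\<dots> \<le> M * (E.list.nrm p)\<^sup>2" using M(1) by simp
    finally have "(E.list.nrm (app u p))\<^sup>2 \<le> (sqrt M * E.list.nrm p)\<^sup>2"
      using M(1) by (simp add: power_mult_distrib)
    then show ?thesis by (rule power2_le_imp_le) (use M(1) in simp)
  qed
  then show ?thesis using that[of "sqrt M"] M(1) by simp
qed

text \<open>A list that represents \<open>W\<^sup>*k\<close> up to an error of norm \<open>1/(n + 1)\<close>.\<close>

definition xi :: "'k \<Rightarrow> nat \<Rightarrow> ('e \<times> 'h) list"
  where "xi k n = (SOME r. \<forall>q. cmod (E.gram r q - cinner k (W q)) \<le> inverse (real (Suc n)) * E.list.nrm q)"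

lemma xi: "cmod (E.gram (xi k n) q - cinner k (W q)) \<le> inverse (real (Suc n)) * E.list.nrm q"
proof -
  have "0 < inverse (real (Suc n))" by simp
  moreover have "norm (W p) \<le> 1 * E.list.nrm p" for p using norm_W_le by simp
  ultimately have "\<exists>r. \<forall>q. cmod (E.gram r q - cinner k (W q)) \<le> inverse (real (Suc n)) * E.list.nrm q"
    using E.list.approximate_Riesz[of W 1 "inverse (real (Suc n))" k, OF W_append W_scale] by metis
  then have "\<forall>q. cmod (E.gram (xi k n) q - cinner k (W q)) \<le> inverse (real (Suc n)) * E.list.nrm q"
    unfolding xi_def by (rule someI_ex)
  then show ?thesis ..
qed

lemma xi_tendsto: "(\<lambda>n. E.gram (xi k n) q) \<longlonglongrightarrow> cinner k (W q)"
proof (rule LIM_zero_cancel, rule Lim_null_comparison)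
  show "\<forall>\<^sub>F n in sequentially. norm (E.gram (xi k n) q - cinner k (W q)) \<le> inverse (real (Suc n)) * E.list.nrm q"
    by (rule always_eventually) (rule allI, rule xi)
  show "(\<lambda>n. inverse (real (Suc n)) * E.list.nrm q) \<longlonglongrightarrow> 0"
    by (rule tendsto_mult_left_zero[OF LIMSEQ_inverse_real_of_nat])
qed

lemma nrm_xi_le: "E.list.nrm (xi k n) \<le> norm k + inverse (real (Suc n))"
proof -
  let ?r = "xi k n" and ?e = "inverse (real (Suc n))"
  have "(E.list.nrm ?r)\<^sup>2 = cmod (E.gram ?r ?r)" by (simp only: E.list.s_self) (simp add: norm_power)
  also have "\<dots> \<le> cmod (cinner k (W ?r)) + ?e * E.list.nrm ?r"
    using xi[of k n ?r] norm_triangle_sub[of "E.gram ?r ?r" "cinner k (W ?r)"] by simp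
  also have "cmod (cinner k (W ?r)) \<le> norm k * E.list.nrm ?r"
    using hilbert.Cauchy_Schwarz[of k "W ?r"] mult_left_mono[OF norm_W_le norm_ge_zero] order_trans
    by blast
  finally have "E.list.nrm ?r * E.list.nrm ?r \<le> (norm k + ?e) * E.list.nrm ?r"
    by (simp add: power2_eq_square distrib_right)
  then show ?thesis
    using E.list.nrm_ge_0[of ?r] by (cases "E.list.nrm ?r = 0") auto
qed

text \<open>The vector \<open>W \<rho>(u) W\<^sup>*k\<close>, as a limit over the approximations of \<open>W\<^sup>*k\<close>.\<close>

definition psi0 :: "('e \<Rightarrow>\<^sub>L 'e) \<Rightarrow> 'k \<Rightarrow> 'k"
  where "psi0 u k = lim (\<lambda>n. W (app u (xi k n)))"

lemma psi0_tendsto: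
  assumes "u \<in> adjointable"
  shows "(\<lambda>n. W (app u (xi k n))) \<longlonglongrightarrow> psi0 u k"
proof -
  obtain C where C: "0 \<le> C" "\<And>p. E.list.nrm (app u p) \<le> C * E.list.nrm p"
    using app_bounded[OF assms] by blast
  have "norm (W (app u (xi k m)) - W (app u (xi k n))) \<le> C * (inverse (Suc m) + inverse (Suc n))" for m n
  proof -
    have "norm (W (app u (xi k m)) - W (app u (xi k n))) = norm (W (app u (E.list.diff (xi k m) (xi k n))))"
      by (simp add: app_diff W_diff)
    also have "\<dots> \<le> E.list.nrm (app u (E.list.diff (xi k m) (xi k n)))" by (rule norm_W_le)
    also have "\<dots> \<le> C * E.list.nrm (E.list.diff (xi k m) (xi k n))" by (rule C)
    also have "\<dots> \<le> C * (inverse (Suc m) + inverse (Suc n))"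
      by (intro mult_left_mono C(1) E.list.nrm_diff_le[OF xi xi]) auto
    finally show ?thesis .
  qed
  then have "Cauchy (\<lambda>n. W (app u (xi k n)))" by (rule Cauchy_inverse_Suc)
  then show ?thesis unfolding psi0_def by (simp add: Cauchy_convergent_iff convergent_LIMSEQ_iff)
qed

lemma psi0_gram_tendsto:
  assumes "u \<in> adjointable"
  shows "(\<lambda>n. E.gram (xi l n) (app u (xi k n))) \<longlonglongrightarrow> cinner l (psi0 u k)"
proof -
  obtain C where C: "0 \<le> C" "\<And>p. E.list.nrm (app u p) \<le> C * E.list.nrm p"
    using app_bounded[OF assms] by blast
  have "(\<lambda>n. cinner l (W (app u (xi k n)))) \<longlonglongrightarrow> cinner l (psi0 u k)"
    by (intro bounded_bilinear.tendsto[OF bounded_bilinear_cinner] tendsto_const psi0_tendsto assms)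
  moreover have "(\<lambda>n. E.gram (xi l n) (app u (xi k n)) - cinner l (W (app u (xi k n)))) \<longlonglongrightarrow> 0"
  proof (rule Lim_null_comparison)
    have "norm (E.gram (xi l n) (app u (xi k n)) - cinner l (W (app u (xi k n))))
        \<le> inverse (real (Suc n)) * (C * (norm k + inverse (real (Suc n))))" for n
      using mult_left_mono[OF order_trans[OF C(2) mult_left_mono[OF nrm_xi_le C(1)]], of "inverse (real (Suc n))"]
      by (intro order_trans[OF xi]) auto
    then show "\<forall>\<^sub>F n in sequentially. norm (E.gram (xi l n) (app u (xi k n)) - cinner l (W (app u (xi k n))))
        \<le> inverse (real (Suc n)) * (C * (norm k + inverse (real (Suc n))))"
      by simp
    have "(\<lambda>n. inverse (real (Suc n)) * (C * (norm k + inverse (real (Suc n))))) \<longlonglongrightarrow> 0 * (C * (norm k + 0))"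
      by (intro tendsto_intros LIMSEQ_inverse_real_of_nat)
    then show "(\<lambda>n. inverse (real (Suc n)) * (C * (norm k + inverse (real (Suc n))))) \<longlonglongrightarrow> 0" by simp
  qed
  ultimately show ?thesis using tendsto_add by fastforce
qed

lemma psi0_adjoint:
  assumes "adjoint_pair u v"
  shows "cinner (psi0 v l) k = cinner l (psi0 u k)"
proof (rule LIMSEQ_unique)
  have uv: "u \<in> adjointable" "v \<in> adjointable"
    using assms adjoint_pair_sym[OF assms] by (auto simp: adjointable_def)
  have "(\<lambda>n. cnj (E.gram (xi k n) (app v (xi l n)))) \<longlonglongrightarrow> cnj (cinner k (psi0 v l))"
    by (intro tendsto_cnj psi0_gram_tendsto uv)
  moreover have "cnj (E.gram (xi k n) (app v (xi l n))) = E.gram (xi l n) (app u (xi k n))" for n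
    by (simp only: E.gram_commute[symmetric] gram_app_adjoint'[OF assms])
  ultimately show "(\<lambda>n. E.gram (xi l n) (app u (xi k n))) \<longlonglongrightarrow> cinner (psi0 v l) k"
    by (simp flip: cinner_commute)
  show "(\<lambda>n. E.gram (xi l n) (app u (xi k n))) \<longlonglongrightarrow> cinner l (psi0 u k)"
    by (rule psi0_gram_tendsto[OF uv(1)])
qed

lemma norm_psi0_le:
  assumes "u \<in> adjointable" "0 \<le> C" and C: "\<And>p. E.list.nrm (app u p) \<le> C * E.list.nrm p"
  shows "norm (psi0 u k) \<le> C * norm k"
proof (rule tendsto_le[OF sequentially_bot _ tendsto_norm[OF psi0_tendsto[OF assms(1)]]])
  have "norm (W (app u (xi k n))) \<le> C * (norm k + inverse (real (Suc n)))" for n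
    using norm_W_le C mult_left_mono[OF nrm_xi_le assms(2)] by (meson order_trans)
  then show "\<forall>\<^sub>F n in sequentially. norm (W (app u (xi k n))) \<le> C * (norm k + inverse (real (Suc n)))" by simp
  have "(\<lambda>n. C * (norm k + inverse (real (Suc n)))) \<longlonglongrightarrow> C * (norm k + 0)"
    by (intro tendsto_intros LIMSEQ_inverse_real_of_nat)
  then show "(\<lambda>n. C * (norm k + inverse (real (Suc n)))) \<longlonglongrightarrow> C * norm k" by simp
qed

text \<open>The operator \<open>W \<rho>(u) W\<^sup>*\<close> on \<open>H\<^sub>2\<close>. It is bounded and complex linear for adjointable \<open>u\<close>; linearity
  follows from the existence of the formal adjoint.\<close>

definition Psi0 :: "('e \<Rightarrow>\<^sub>L 'e) \<Rightarrow> ('k \<Rightarrow>\<^sub>L 'k)" where "Psi0 u = Blinfun (psi0 u)"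

lemma Psi0:
  assumes "u \<in> adjointable"
  shows Psi0_apply: "blinfun_apply (Psi0 u) k = psi0 u k" and Psi0_bounded: "Psi0 u \<in> bounded_ops"
proof -
  obtain C where C: "0 \<le> C" "\<And>p. E.list.nrm (app u p) \<le> C * E.list.nrm p"
    using app_bounded[OF assms] by blast
  have adj: "cinner (psi0 u x) y = cinner x (psi0 (module_adj ip u) y)" for x y
    using psi0_adjoint[OF adjoint_pair_sym[OF adjoint_pair_module_adj[OF assms]]] .
  from adjoint_pair_blinfun[OF adj norm_psi0_le[OF assms C]]
  show "blinfun_apply (Psi0 u) k = psi0 u k" "Psi0 u \<in> bounded_ops" by (simp_all add: Psi0_def)
qed

lemma Psi0_add:
  assumes u: "u \<in> adjointable" and v: "v \<in> adjointable"
  shows "Psi0 (u + v) = Psi0 u + Psi0 v"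
proof (rule blinfun_eqI)
  fix k
  have "psi0 (u + v) k = psi0 u k + psi0 v k"
    by (rule LIMSEQ_unique[OF psi0_tendsto[OF adjointable_add[OF u v]]])
      (simp add: W_app_add tendsto_add psi0_tendsto u v)
  then show "Psi0 (u + v) k = (Psi0 u + Psi0 v) k"
    by (simp add: Psi0_apply u v adjointable_add blinfun.add_left)
qed

lemma Psi0_scaleC:
  assumes u: "u \<in> adjointable"
  shows "Psi0 (c *\<^sub>C u) = c *\<^sub>C Psi0 u"
proof (rule blinfun_eqI)
  fix k
  have "psi0 (c *\<^sub>C u) k = c *\<^sub>C psi0 u k"
    by (rule LIMSEQ_unique[OF psi0_tendsto[OF adjointable_scaleC[OF u]]])
      (simp add: W_app_scaleC bounded_linear.tendsto[OF bounded_linear_scaleC] psi0_tendsto u)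
  then show "Psi0 (c *\<^sub>C u) k = (c *\<^sub>C Psi0 u) k"
    by (simp add: Psi0_apply u adjointable_scaleC scaleC_blinfun_apply)
qed

end

section \<open>The completely positive extension\<close>

text \<open>In addition, a positive functional \<open>\<tau>\<close> on \<open>\<A>\<close> and a vector \<open>x0\<close> that define a state on the operators.
  If \<open>H\<^sub>2 = 0\<close>, the functional need not be normalized, so that \<open>\<E> = 0\<close> is covered.\<close>

locale semi_map_state = semi_map act ip \<phi> \<Phi>
  for act :: "'e::cbanach \<Rightarrow> 'a::unital_cstar_algebra \<Rightarrow> 'e" and ip :: "'e \<Rightarrow> 'e \<Rightarrow> 'a"
    and \<phi> :: "'a \<Rightarrow> ('h::chilbert_space \<Rightarrow>\<^sub>L 'h)" and \<Phi> :: "'e \<Rightarrow> ('h \<Rightarrow>\<^sub>L 'k::chilbert_space)" +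
  fixes \<tau> :: "'a \<Rightarrow> complex" and x0 :: 'e
  assumes tau: "positive_functional \<tau>"
    and tau_x0: "\<tau> (ip x0 x0) = 1 \<or> (\<forall>k::'k. k = 0)"
begin

lemma tau_add: "\<tau> (a + b) = \<tau> a + \<tau> b"
  and tau_scaleC: "\<tau> (c *\<^sub>C a) = c * \<tau> a"
  and tau_nonneg: "\<tau> (star b * b) \<in> \<real>\<^sub>\<ge>\<^sub>0"
  using tau by (simp_all add: positive_functional_def)

lemma tau_zero: "\<tau> 0 = 0"
  using tau_scaleC[of 0 0] by simp

lemma tau_sum: "\<tau> (\<Sum>i\<in>I. f i) = (\<Sum>i\<in>I. \<tau> (f i))"
  by (induction I rule: infinite_finite_induct) (simp_all add: tau_zero tau_add)

text \<open>The vector functional \<open>u \<mapsto> \<tau>(\<langle>x0, u x0\<rangle>)\<close>.\<close>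

definition state :: "('e \<Rightarrow>\<^sub>L 'e) \<Rightarrow> complex" where "state u = \<tau> (ip x0 (u x0))"

lemma state_add: "state (u + v) = state u + state v"
  by (simp add: state_def blinfun.add_left ip_add_right tau_add)

lemma state_scaleC: "state (c *\<^sub>C u) = c * state u"
  by (simp add: state_def scaleC_blinfun_apply ip_scaleC_right tau_scaleC)

lemma psd_tau_star_mult: "psd_matrix n (\<lambda>i j. \<tau> (star (b i) * b j))"
  unfolding psd_matrix_def
proof
  fix c :: "nat \<Rightarrow> complex"
  define B where "B = (\<Sum>i<n. c i *\<^sub>C b i)"
  have "star B * B = (\<Sum>i<n. \<Sum>j<n. (cnj (c i) * c j) *\<^sub>C (star (b i) * b j))"
    by (simp add: B_def star_sum sum_product star_scaleC scaleC_mult_left scaleC_mult_right scaleC_scaleC mult.commute[of "cnj _"])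
  then have "\<tau> (star B * B) = (\<Sum>i<n. \<Sum>j<n. cnj (c i) * c j * \<tau> (star (b i) * b j))"
    by (simp add: tau_sum tau_scaleC)
  then show "(\<Sum>i<n. \<Sum>j<n. cnj (c i) * c j * \<tau> (star (b i) * b j)) \<in> \<real>\<^sub>\<ge>\<^sub>0"
    using tau_nonneg[of B] by simp
qed

lemma psd_tau_ip: "psd_matrix n (\<lambda>i j. \<tau> (ip (z i) (z j)))"
  unfolding psd_matrix_def
proof
  fix c :: "nat \<Rightarrow> complex"
  define B where "B = (\<Sum>i<n. c i *\<^sub>C z i)"
  have "ip B B = (\<Sum>i<n. \<Sum>j<n. (cnj (c i) * c j) *\<^sub>C ip (z i) (z j))"
    unfolding B_def ip_sum_left unfolding ip_sum_right
    by (simp add: ip_scaleC_left ip_scaleC_right scaleC_scaleC mult.commute)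
  then have "\<tau> (ip B B) = (\<Sum>i<n. \<Sum>j<n. cnj (c i) * c j * \<tau> (ip (z i) (z j)))"
    by (simp add: tau_sum tau_scaleC)
  moreover obtain b where "ip B B = star b * b" using ip_positive by blast
  ultimately show "(\<Sum>i<n. \<Sum>j<n. cnj (c i) * c j * \<tau> (ip (z i) (z j))) \<in> \<real>\<^sub>\<ge>\<^sub>0"
    using tau_nonneg[of b] by simp
qed

lemma psd_state:
  assumes u: "\<And>i. u i \<in> adjointable"
  shows "psd_matrix n (\<lambda>i j. state ((module_adj ip (u i) o\<^sub>L u j) + rank_one act ip (y i) (y j)))"
proof -
  have eq: "state ((module_adj ip (u i) o\<^sub>L u j) + rank_one act ip (y i) (y j))
      = \<tau> (ip (u i x0) (u j x0)) + \<tau> (star (ip (y i) x0) * ip (y j) x0)" for i j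
  proof -
    have "ip x0 (module_adj ip (u i) (u j x0)) = ip (u i x0) (u j x0)"
      using ip_module_adj[OF module_adj_adjointable[OF u[of i]]] module_adj_module_adj[OF u[of i]] by metis
    then show ?thesis
      by (simp add: state_def blinfun.add_left ip_add_right rank_one_apply ip_act_right tau_add ip_star)
  qed
  show ?thesis
    using psd_tau_ip[of n "\<lambda>i. u i x0"] psd_tau_star_mult[of n "\<lambda>i. ip (y i) x0"]
    unfolding eq psd_matrix_def by (auto simp: distrib_left sum.distrib intro: nonneg_Reals_add_I)
qed

text \<open>The form of the defect \<open>1 - WW\<^sup>*\<close>.\<close>

definition defect :: "'k \<Rightarrow> 'k \<Rightarrow> complex"
  where "defect k l = cinner k (l - psi0 id_blinfun l)"

lemma semi_inner_defect: "semi_inner (+) scaleC defect"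
proof
  have T: "blinfun_apply (Psi0 id_blinfun) k = psi0 id_blinfun k" for k
    by (rule Psi0_apply[OF adjointable_id])
  have add: "psi0 id_blinfun (p + q) = psi0 id_blinfun p + psi0 id_blinfun q" for p q
    by (simp only: T[symmetric] blinfun.add_right)
  have scale: "psi0 id_blinfun (c *\<^sub>C p) = c *\<^sub>C psi0 id_blinfun p" for c p
    using Psi0_bounded[OF adjointable_id] by (simp add: T[symmetric] bounded_ops_iff)
  show "defect p (q + r) = defect p q + defect p r" for p q r
    by (simp add: defect_def add cinner_add_right cinner_diff_right)
  show "defect p (c *\<^sub>C q) = c * defect p q" for c p q
    by (simp add: defect_def scale cinner_scaleC_right cinner_diff_right algebra_simps)
  show "defect p q = cnj (defect q p)" for p q
  proof -
    have "cinner p (psi0 id_blinfun q) = cinner (psi0 id_blinfun p) q"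
      using psi0_adjoint[OF adjoint_pair_id] by metis
    then show ?thesis by (simp add: defect_def cinner_diff_right flip: cinner_commute)
  qed
  show "0 \<le> Re (defect p p)" for p
  proof -
    have "norm (psi0 id_blinfun p) \<le> 1 * norm p"
      by (rule norm_psi0_le) (simp_all add: adjointable_id app_id)
    then have "Re (cinner p (psi0 id_blinfun p)) \<le> norm p * norm p"
      using hilbert.Cauchy_Schwarz[of p "psi0 id_blinfun p"] complex_Re_le_cmod[of "cinner p (psi0 id_blinfun p)"]
        mult_left_mono[of "norm (psi0 id_blinfun p)" "norm p" "norm p"] by simp
    then show ?thesis
      using hilbert.nrm_sq[of p] by (simp add: defect_def cinner_diff_right power2_eq_square)
  qed
qed

text \<open>The required unital map \<open>\<psi>(u) = W \<rho>(u) W\<^sup>* + \<omega>(u) (1 - W W\<^sup>*)\<close>, where \<open>W W\<^sup>* = Psi0 id_blinfun\<close>.\<close>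

definition Psi :: "('e \<Rightarrow>\<^sub>L 'e) \<Rightarrow> ('k \<Rightarrow>\<^sub>L 'k)"
  where "Psi u = Psi0 u + state u *\<^sub>C (id_blinfun - Psi0 id_blinfun)"

lemma Psi_id: "Psi id_blinfun = id_blinfun"
proof (cases "\<forall>k::'k. k = 0")
  case True
  show ?thesis by (rule blinfun_eqI) (metis True)
next
  case False
  then have "state id_blinfun = 1" using tau_x0 by (auto simp: state_def)
  then show ?thesis by (simp add: Psi_def scaleC_one)
qed

lemma Psi_bounded: "u \<in> adjointable \<Longrightarrow> Psi u \<in> bounded_ops"
  using Psi0_bounded[of u] Psi0_bounded[OF adjointable_id]
  by (simp add: bounded_ops_iff Psi_def blinfun.add_left blinfun.diff_left scaleC_blinfun_apply
      complex_vector.scale_right_distrib complex_vector.scale_right_diff_distrib scaleC_scaleC mult.commute)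

lemma Psi_add: "u \<in> adjointable \<Longrightarrow> v \<in> adjointable \<Longrightarrow> Psi (u + v) = Psi u + Psi v"
  by (simp add: Psi_def Psi0_add state_add scaleC_add_left)

lemma Psi_scaleC: "u \<in> adjointable \<Longrightarrow> Psi (c *\<^sub>C u) = c *\<^sub>C Psi u"
  by (simp add: Psi_def Psi0_scaleC state_scaleC complex_vector.scale_right_distrib scaleC_scaleC)

lemma Psi_zero: "Psi 0 = 0"
  using Psi_scaleC[OF adjointable_id, of 0] by simp

lemma Psi_sum:
  assumes "\<And>i. i \<in> I \<Longrightarrow> f i \<in> adjointable"
  shows "Psi (\<Sum>i\<in>I. f i) = (\<Sum>i\<in>I. Psi (f i))"
  using assms by (induction I rule: infinite_finite_induct) (simp_all add: Psi_zero Psi_add adjointable_sum)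

lemma cinner_Psi:
  assumes "u \<in> adjointable"
  shows "cinner k (Psi u l) = cinner k (psi0 u l) + defect k l * state u"
  by (simp add: Psi_def blinfun.add_left blinfun.diff_left scaleC_blinfun_apply Psi0_apply assms
      adjointable_id cinner_add_right cinner_scaleC_right defect_def)

text \<open>The map \<open>x \<otimes> h \<mapsto> \<langle>y, x\<rangle> \<otimes> h\<close> from \<open>\<E> \<otimes> H\<^sub>1\<close> to \<open>\<A> \<otimes> H\<^sub>1\<close>, which is the action of \<open>y\<^sup>*\<close>.\<close>

definition column :: "'e \<Rightarrow> ('e \<times> 'h) list \<Rightarrow> ('a \<times> 'h) list"
  where "column y = map (\<lambda>(x, h). (ip y x, h))"

lemma gram_column: "A.gram (column y p) (column z q) = E.gram p (app (rank_one act ip y z) q)"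
  by (simp add: A.gram_eq_sum gram_app_right column_def case_prod_unfold rank_one_apply ip_act_right ip_star)

lemma gram_column_single: "A.gram (column y p) [(a, h)] = E.gram p [(act y a, h)]"
  by (simp add: A.gram_eq_sum E.gram_eq_sum column_def case_prod_unfold ip_act_right ip_star)

lemma gram_single_add: "E.gram p [(x + y, h)] = E.gram p [(x, h)] + E.gram p [(y, h)]"
  by (simp add: E.gram_eq_sum ip_add_right phi_add blinfun.add_left cinner_add_right sum.distrib)

text \<open>Positivity of the block map at the matrix \<open>(Y\<^sub>i\<^sup>* Y\<^sub>j)\<close> with \<open>Y\<^sub>i = [u\<^sub>i x\<^sub>i; y\<^sub>i\<^sup>* a\<^sub>i]\<close>, evaluated at the vectors
  \<open>(k\<^sub>i, h\<^sub>i)\<close>.\<close>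

lemma row_positive:
  assumes u: "\<And>i. u i \<in> adjointable"
  shows "(\<Sum>i<n. \<Sum>j<n::nat.
      cinner (k i) (Psi ((module_adj ip (u i) o\<^sub>L u j) + rank_one act ip (y i) (y j)) (k j))
    + cinner (k i) (\<Phi> (module_adj ip (u i) (x j) + act (y i) (a j)) (h j))
    + cinner (\<Phi> (module_adj ip (u j) (x i) + act (y j) (a i)) (h i)) (k j)
    + cinner (h i) (\<phi> (ip (x i) (x j) + star (a i) * a j) (h j))) \<in> \<real>\<^sub>\<ge>\<^sub>0"
proof -
  define U where "U i j = (module_adj ip (u i) o\<^sub>L u j) + rank_one act ip (y i) (y j)" for i j
  define z where "z i j = module_adj ip (u i) (x j) + act (y i) (a j)" for i j
  have U: "U i j \<in> adjointable" for i j
    by (simp add: U_def adjointable_add adjointable_compose module_adj_adjointable u adjointable_rank_one)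
  \<comment> \<open>\<open>T\<close> is the entry without the state; \<open>S m\<close> is \<open>T\<close> with \<open>W\<^sup>*(k i)\<close> replaced by its \<open>m\<close>-th approximation.\<close>
  define T where "T i j = cinner (k i) (psi0 (U i j) (k j)) + cinner (k i) (\<Phi> (z i j) (h j))
    + cinner (\<Phi> (z j i) (h i)) (k j) + cinner (h i) (\<phi> (ip (x i) (x j) + star (a i) * a j) (h j))" for i j
  define S where "S m i j = E.gram (xi (k i) m) (app (U i j) (xi (k j) m)) + E.gram (xi (k i) m) [(z i j, h j)]
    + cnj (E.gram (xi (k j) m) [(z j i, h i)]) + cinner (h i) (\<phi> (ip (x i) (x j) + star (a i) * a j) (h j))" for m i j
  have "(\<lambda>m. S m i j) \<longlonglongrightarrow> T i j" for i j
  proof -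
    have "(\<lambda>m. S m i j) \<longlonglongrightarrow> cinner (k i) (psi0 (U i j) (k j)) + cinner (k i) (W [(z i j, h j)])
      + cnj (cinner (k j) (W [(z j i, h i)])) + cinner (h i) (\<phi> (ip (x i) (x j) + star (a i) * a j) (h j))"
      unfolding S_def by (intro tendsto_intros psi0_gram_tendsto U xi_tendsto)
    then show ?thesis by (simp add: T_def W_single flip: cinner_commute)
  qed
  then have lim: "(\<lambda>m. \<Sum>i<n. \<Sum>j<n. S m i j) \<longlonglongrightarrow> (\<Sum>i<n. \<Sum>j<n. T i j)"
    by (intro tendsto_sum)
  have "(\<Sum>i<n. \<Sum>j<n. S m i j) \<in> \<real>\<^sub>\<ge>\<^sub>0" for m
  proof -
    define r where "r i = xi (k i) m" for i
    \<comment> \<open>The two rows of the block matrix, applied to the vector whose first component is \<open>W\<^sup>*k\<^sub>i\<close>.\<close>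
    define p where "p i = app (u i) (r i) @ [(x i, h i)]" for i
    define q where "q i = column (y i) (r i) @ [(a i, h i)]" for i
    have adj: "adjoint_pair (module_adj ip (u i)) (u i)" for i
      by (rule adjoint_pair_sym[OF adjoint_pair_module_adj[OF u]])
    have single: "E.gram (app (u i) (r i)) [(w, g)] = E.gram (r i) [(module_adj ip (u i) w, g)]" for i w g
      using gram_app_adjoint'[OF adj, of i "r i" "[(w, g)]"] by (simp add: app_def)
    have "S m i j = E.gram (p i) (p j) + A.gram (q i) (q j)" for i j
    proof -
      have 1: "E.gram (r i) (app (U i j) (r j))
          = E.gram (app (u i) (r i)) (app (u j) (r j)) + A.gram (column (y i) (r i)) (column (y j) (r j))"
        by (simp add: U_def gram_app_add gram_app_adjoint[OF adj] gram_column)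
      have 2: "E.gram (r i) [(z i j, h j)]
          = E.gram (app (u i) (r i)) [(x j, h j)] + A.gram (column (y i) (r i)) [(a j, h j)]" for i j
        by (simp add: z_def gram_single_add single gram_column_single)
      have 3: "cnj (E.gram (r j) [(z j i, h i)])
          = E.gram [(x i, h i)] (app (u j) (r j)) + A.gram [(a i, h i)] (column (y j) (r j))"
        unfolding 2 complex_cnj_add
        by (rule arg_cong2[where f = "(+)", OF E.gram_commute[symmetric] A.gram_commute[symmetric]])
      have 4: "cinner (h i) (\<phi> (ip (x i) (x j) + star (a i) * a j) (h j))
          = E.gram [(x i, h i)] [(x j, h j)] + A.gram [(a i, h i)] [(a j, h j)]"
        by (simp add: E.gram_single A.gram_single phi_add blinfun.add_left cinner_add_right)
      show ?thesis
        unfolding S_def r_def[symmetric] unfolding 3 unfolding 1 2 4 p_def q_def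
        by (simp add: E.gram_append_left E.gram_append_right A.gram_append_left A.gram_append_right)
    qed
    then show ?thesis
      using nonneg_Reals_add_I[OF E.gram_sum_nonneg[of p n] A.gram_sum_nonneg[of q n]]
      by (simp add: sum.distrib)
  qed
  then have "(\<Sum>i<n. \<Sum>j<n. T i j) \<in> \<real>\<^sub>\<ge>\<^sub>0"
    by (intro Lim_in_closed_set[OF closed_nonneg_Reals_complex _ sequentially_bot lim]) simp
  moreover have "(\<Sum>i<n. \<Sum>j<n. defect (k i) (k j) * state (U i j)) \<in> \<real>\<^sub>\<ge>\<^sub>0"
    unfolding U_def by (intro Schur_product[OF semi_inner_defect psd_state] u)
  ultimately have "(\<Sum>i<n. \<Sum>j<n. T i j) + (\<Sum>i<n. \<Sum>j<n. defect (k i) (k j) * state (U i j)) \<in> \<real>\<^sub>\<ge>\<^sub>0"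
    by (rule nonneg_Reals_add_I)
  also have "(\<Sum>i<n. \<Sum>j<n. T i j) + (\<Sum>i<n. \<Sum>j<n. defect (k i) (k j) * state (U i j))
      = (\<Sum>i<n. \<Sum>j<n. cinner (k i) (Psi (U i j) (k j)) + cinner (k i) (\<Phi> (z i j) (h j))
        + cinner (\<Phi> (z j i) (h i)) (k j) + cinner (h i) (\<phi> (ip (x i) (x j) + star (a i) * a j) (h j)))"
    unfolding sum.distrib[symmetric]
    by (intro sum.cong refl) (simp add: T_def cinner_Psi[OF U])
  finally show ?thesis unfolding U_def z_def .
qed

text \<open>The case \<open>x\<^sub>i = y\<^sub>i = 0\<close>, \<open>a\<^sub>i = 0\<close>, \<open>h\<^sub>i = 0\<close> of \<open>row_positive\<close>, summed over the rows of the matrix \<open>Y\<close>.\<close>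

lemma completely_positive_Psi: "completely_positive (K1 act ip) Psi"
  unfolding completely_positive_def
proof (intro conjI ballI allI impI)
  note carrier = subsetD[OF K1_subset_adjointable]
  show "Psi u \<in> bounded_ops" if "u \<in> alg_carrier (K1 act ip)" for u
    using carrier[OF that] by (rule Psi_bounded)
  show "Psi (u + v) = Psi u + Psi v" if "u \<in> alg_carrier (K1 act ip)" "v \<in> alg_carrier (K1 act ip)" for u v
    using carrier[OF that(1)] carrier[OF that(2)] by (rule Psi_add)
  show "Psi (alg_scale (K1 act ip) c u) = c *\<^sub>C Psi u" if "u \<in> alg_carrier (K1 act ip)" for c u
    using Psi_scaleC[OF carrier[OF that]] by (simp add: K1_def)
  fix n X assume "matrix_positive (K1 act ip) n X"
  then obtain Y where carrier_Y: "\<forall>i<n. \<forall>j<n. Y i j \<in> alg_carrier (K1 act ip)"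
    and X_eq: "\<forall>i<n. \<forall>j<n. X i j =
      (\<Sum>m<n. alg_mult (K1 act ip) (alg_star (K1 act ip) (Y m i)) (Y m j))"
    unfolding matrix_positive_def by blast
  have Y: "Y i j \<in> adjointable" if "i < n" "j < n" for i j
    using carrier carrier_Y that by blast
  have X: "X i j = (\<Sum>m<n. module_adj ip (Y m i) o\<^sub>L Y m j)" if "i < n" "j < n" for i j
    using X_eq that by (simp add: K1_def)
  \<comment> \<open>Only the entries of \<open>Y\<close> at indices below \<open>n\<close> are known to be adjointable.\<close>
  define V where "V m i = (if m < n \<and> i < n then Y m i else id_blinfun)" for m i
  have V: "V m i \<in> adjointable" for m i by (simp add: V_def Y adjointable_id)
  have zero: "rank_one act ip 0 0 = 0"
    using act_scaleC_left[of 0 0] by (intro blinfun_eqI) (simp add: rank_one_apply)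
  have act0: "act 0 0 = 0" using act_scaleC_left[of 0 0] by simp
  show "op_matrix_positive n (\<lambda>i j. Psi (X i j))"
    unfolding op_matrix_positive_iff
  proof
    fix k :: "nat \<Rightarrow> 'k"
    have "(\<Sum>i<n. \<Sum>j<n. cinner (k i) (Psi (module_adj ip (V m i) o\<^sub>L V m j) (k j))) \<in> \<real>\<^sub>\<ge>\<^sub>0" for m
      using row_positive[of "V m", where y = "\<lambda>_. 0" and x = "\<lambda>_. 0" and a = "\<lambda>_. 0" and k = k
          and h = "\<lambda>_. 0" and n = n]
      by (simp add: V zero act0 blinfun.zero_right Phi_zero phi_zero)
    then have "(\<Sum>m<n. \<Sum>i<n. \<Sum>j<n. cinner (k i) (Psi (module_adj ip (V m i) o\<^sub>L V m j) (k j))) \<in> \<real>\<^sub>\<ge>\<^sub>0"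
      by (rule nonneg_Reals_sum)
    also have "(\<Sum>m<n. \<Sum>i<n. \<Sum>j<n. cinner (k i) (Psi (module_adj ip (V m i) o\<^sub>L V m j) (k j)))
        = (\<Sum>i<n. \<Sum>m<n. \<Sum>j<n. cinner (k i) (Psi (module_adj ip (V m i) o\<^sub>L V m j) (k j)))"
      by (rule sum.swap)
    also have "\<dots> = (\<Sum>i<n. \<Sum>j<n. \<Sum>m<n. cinner (k i) (Psi (module_adj ip (V m i) o\<^sub>L V m j) (k j)))"
      by (intro sum.cong refl sum.swap)
    also have "\<dots> = (\<Sum>i<n. \<Sum>j<n. cinner (k i) (Psi (X i j) (k j)))"
    proof (intro sum.cong refl)
      fix i j assume ij: "i \<in> {..<n}" "j \<in> {..<n}"
      have "X i j = (\<Sum>m<n. module_adj ip (V m i) o\<^sub>L V m j)"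
        unfolding X[OF ij[unfolded lessThan_iff]] by (intro sum.cong) (use ij in \<open>auto simp: V_def\<close>)
      then have "Psi (X i j) = (\<Sum>m<n. Psi (module_adj ip (V m i) o\<^sub>L V m j))"
        by (simp add: Psi_sum V module_adj_adjointable adjointable_compose)
      then show "(\<Sum>m<n. cinner (k i) (Psi (module_adj ip (V m i) o\<^sub>L V m j) (k j))) = cinner (k i) (Psi (X i j) (k j))"
        by (simp add: blinfun.sum_left cinner_sum_right)
    qed
    finally show "(\<Sum>i<n. \<Sum>j<n. cinner (k i) (Psi (X i j) (k j))) \<in> \<real>\<^sub>\<ge>\<^sub>0" .
  qed
qed

end

section \<open>The block map on the linking algebra\<close>

lemma block_op_apply: "blinfun_apply (block_op P Q R S) p = (P (fst p) + Q (snd p), R (fst p) + S (snd p))"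
proof -
  have "bounded_linear (\<lambda>(k, h). (P k + Q h, R k + S h))"
    unfolding case_prod_unfold
    by (intro bounded_linear_Pair bounded_linear_add
        bounded_linear_compose[OF blinfun.bounded_linear_right bounded_linear_fst]
        bounded_linear_compose[OF blinfun.bounded_linear_right bounded_linear_snd])
  then show ?thesis by (simp add: block_op_def bounded_linear_Blinfun_apply case_prod_unfold)
qed

context semi_map_state
begin

abbreviation "Block \<equiv> block_map Psi \<Phi> \<phi>"

lemma Block_apply:
  "blinfun_apply (Block (u, x, y, a)) p = (Psi u (fst p) + \<Phi> x (snd p), hilbert_adj (\<Phi> y) (fst p) + \<phi> a (snd p))"
  by (simp add: block_map_def block_op_apply)

lemma hilbert_adj_Phi_add: "hilbert_adj (\<Phi> (x + y)) = hilbert_adj (\<Phi> x) + hilbert_adj (\<Phi> y)"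
  by (intro blinfun_eqI cinner_eqI)
    (simp only: hilbert_adj(2)[OF Phi_bounded] blinfun.add_left cinner_add_right,
      simp only: Phi_add blinfun.add_left cinner_add_left)

lemma hilbert_adj_Phi_scaleC: "hilbert_adj (\<Phi> (cnj c *\<^sub>C x)) = c *\<^sub>C hilbert_adj (\<Phi> x)"
  by (intro blinfun_eqI cinner_eqI)
    (simp only: hilbert_adj(2)[OF Phi_bounded] scaleC_blinfun_apply cinner_scaleC_right,
      simp add: Phi_scaleC scaleC_blinfun_apply cinner_scaleC_left)

lemma Block_add:
  assumes "fst X \<in> adjointable" "fst Y \<in> adjointable"
  shows "Block (X + Y) = Block X + Block Y"
  using assms
  by (cases X, cases Y)
    (auto intro!: blinfun_eqI simp: Block_apply Psi_add Phi_add phi_add hilbert_adj_Phi_add[unfolded Phi_add] blinfun.add_left)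

lemma Block_zero: "Block 0 = 0"
  using Block_add[of 0 0] adjointable_sum[of "{}"] by simp

lemma Block_sum:
  assumes "\<And>i. i \<in> I \<Longrightarrow> fst (f i) \<in> adjointable"
  shows "Block (\<Sum>i\<in>I. f i) = (\<Sum>i\<in>I. Block (f i))"
  using assms
  by (induction I rule: infinite_finite_induct)
    (simp_all add: Block_zero Block_add fst_sum adjointable_sum)

lemma Block_bounded:
  assumes "fst X \<in> adjointable"
  shows "Block X \<in> bounded_ops"
  using assms Psi_bounded[of "fst X"] Phi_bounded[of "fst (snd X)"] phi_bounded[of "snd (snd (snd X))"]
    hilbert_adj(3)[OF Phi_bounded, of "fst (snd (snd X))"]
  by (cases X) (simp add: bounded_ops_iff Block_apply scaleC_prod_def complex_vector.scale_right_distrib)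

lemma completely_positive_Block: "completely_positive (linking_algebra act ip) Block"
  unfolding completely_positive_def
proof (intro conjI ballI allI impI)
  let ?L = "linking_algebra act ip"
  have carrier: "fst X \<in> adjointable" if "X \<in> alg_carrier ?L" for X
    using that K1_subset_adjointable by (auto simp: linking_algebra_def)
  show "Block X \<in> bounded_ops" if "X \<in> alg_carrier ?L" for X
    using carrier[OF that] by (rule Block_bounded)
  show "Block (X + Y) = Block X + Block Y" if "X \<in> alg_carrier ?L" "Y \<in> alg_carrier ?L" for X Y
    using carrier[OF that(1)] carrier[OF that(2)] by (rule Block_add)
  show "Block (alg_scale ?L c X) = c *\<^sub>C Block X" if "X \<in> alg_carrier ?L" for c X
    using carrier[OF that]
    by (cases X) (auto intro!: blinfun_eqI simp: linking_algebra_def Block_apply Psi_scaleC Phi_scaleC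
        phi_scaleC hilbert_adj_Phi_scaleC[unfolded Phi_scaleC] scaleC_blinfun_apply scaleC_prod_def complex_vector.scale_right_distrib)
  fix n X assume "matrix_positive ?L n X"
  then obtain Y where carrier_Y: "\<forall>i<n. \<forall>j<n. Y i j \<in> alg_carrier ?L"
    and X: "\<forall>i<n. \<forall>j<n. X i j = (\<Sum>m<n. alg_mult ?L (alg_star ?L (Y m i)) (Y m j))"
    unfolding matrix_positive_def by blast
  have Y: "fst (Y i j) \<in> adjointable" if "i < n" "j < n" for i j
    using carrier carrier_Y that by blast
  \<comment> \<open>Only the entries of \<open>Y\<close> at indices below \<open>n\<close> are known to lie in the algebra.\<close>
  define u where "u m i = (if m < n \<and> i < n then fst (Y m i) else id_blinfun)" for m i
  have u: "u m i \<in> adjointable" for m i by (simp add: u_def Y adjointable_id)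
  define x where "x m i = fst (snd (Y m i))" for m i
  define y where "y m i = fst (snd (snd (Y m i)))" for m i
  define a where "a m i = snd (snd (snd (Y m i)))" for m i
  define Z where "Z m i j = ((module_adj ip (u m i) o\<^sub>L u m j) + rank_one act ip (y m i) (y m j),
      module_adj ip (u m i) (x m j) + act (y m i) (a m j), module_adj ip (u m j) (x m i) + act (y m j) (a m i),
      ip (x m i) (x m j) + star (a m i) * a m j)" for m i j
  have Z: "fst (Z m i j) \<in> adjointable" for m i j
    by (simp add: Z_def u adjointable_add adjointable_compose module_adj_adjointable adjointable_rank_one)
  have XZ: "X i j = (\<Sum>m<n. Z m i j)" if "i < n" "j < n" for i j
    unfolding X[rule_format, OF that]
    by (intro sum.cong refl)
      (use that in \<open>simp add: Z_def u_def x_def y_def a_def linking_algebra_def case_prod_unfold star_star\<close>)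
  show "op_matrix_positive n (\<lambda>i j. Block (X i j))"
    unfolding op_matrix_positive_iff
  proof
    fix g :: "nat \<Rightarrow> 'k \<times> 'h"
    have "(\<Sum>i<n. \<Sum>j<n. cinner (g i) (Block (Z m i j) (g j))) \<in> \<real>\<^sub>\<ge>\<^sub>0" for m
      using row_positive[of "u m", where y = "y m" and x = "x m" and a = "a m" and k = "\<lambda>i. fst (g i)"
          and h = "\<lambda>i. snd (g i)" and n = n, OF u]
      by (simp add: Z_def Block_apply cinner_prod_def cinner_add_right hilbert_adj(2) Phi_bounded add.assoc)
    then have "(\<Sum>m<n. \<Sum>i<n. \<Sum>j<n. cinner (g i) (Block (Z m i j) (g j))) \<in> \<real>\<^sub>\<ge>\<^sub>0"
      by (rule nonneg_Reals_sum)
    also have "(\<Sum>m<n. \<Sum>i<n. \<Sum>j<n. cinner (g i) (Block (Z m i j) (g j)))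
        = (\<Sum>i<n. \<Sum>m<n. \<Sum>j<n. cinner (g i) (Block (Z m i j) (g j)))"
      by (rule sum.swap)
    also have "\<dots> = (\<Sum>i<n. \<Sum>j<n. \<Sum>m<n. cinner (g i) (Block (Z m i j) (g j)))"
      by (intro sum.cong refl sum.swap)
    also have "\<dots> = (\<Sum>i<n. \<Sum>j<n. cinner (g i) (Block (X i j) (g j)))"
      by (intro sum.cong refl) (simp add: XZ Block_sum Z blinfun.sum_left cinner_sum_right)
    finally show "(\<Sum>i<n. \<Sum>j<n. cinner (g i) (Block (X i j) (g j))) \<in> \<real>\<^sub>\<ge>\<^sub>0" .
  qed
qed

end

theorem theorem3p3:
  fixes act :: "'e::cbanach \<Rightarrow> 'a::unital_cstar_algebra \<Rightarrow> 'e"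
    and ip :: "'e \<Rightarrow> 'e \<Rightarrow> 'a"
    and \<phi> :: "'a \<Rightarrow> ('h::chilbert_space \<Rightarrow>\<^sub>L 'h)"
    and \<Phi> :: "'e \<Rightarrow> ('h \<Rightarrow>\<^sub>L 'k::chilbert_space)"
  assumes "hilbert_module act ip"
    and nondegenerate: "(\<exists>x::'e. x \<noteq> 0) \<or> (\<forall>k::'k. k = 0)"
    and "completely_positive full_algebra \<phi>"
    and "completely_semi_map ip \<phi> \<Phi>"
  shows "\<exists>\<psi> :: ('e \<Rightarrow>\<^sub>L 'e) \<Rightarrow> ('k \<Rightarrow>\<^sub>L 'k).
           completely_positive (K1 act ip) \<psi> \<and> \<psi> id_blinfun = id_blinfun \<and>
           completely_positive (linking_algebra act ip) (block_map \<psi> \<Phi> \<phi>)"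
proof -
  interpret semi_map act ip \<phi> \<Phi>
    using assms by (simp add: semi_map_def semi_map_axioms_def)
  obtain \<tau> :: "'a \<Rightarrow> complex" and x0 where \<tau>: "positive_functional \<tau>" "\<tau> (ip x0 x0) = 1 \<or> (\<forall>k::'k. k = 0)"
  proof (cases "\<forall>k::'k. k = 0")
    case True
    have "positive_functional (\<lambda>_::'a. 0)" by (simp add: positive_functional_def)
    with True show ?thesis using that by blast
  next
    case False
    then obtain x :: 'e where "x \<noteq> 0" using nondegenerate by blast
    then have x: "ip x x \<noteq> 0" using ip_definite by blast
    obtain b where b: "ip x x = star b * b" using ip_positive by blast
    with x have "b \<noteq> 0" by auto
    then obtain \<tau> where "positive_functional \<tau>" "\<tau> (star b * b) = 1"
      using positive_functional_exists by blast
    with b show ?thesis using that[of \<tau> x] by simp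
  qed
  interpret semi_map_state act ip \<phi> \<Phi> \<tau> x0
    using \<tau> by unfold_locales
  show ?thesis using completely_positive_Psi Psi_id completely_positive_Block by blast
qed

end
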